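(* Let $p>1$ be an integer. If $G$ is a minimally 3-connected graph with $n\geq 8$ vertices, then $e_p(G)\leq \max\{e_p(W_n),e_p(K_{3,n-3})\}$, with equality if and only if $G\cong W_n$ or $G\cong K_{3,n-3}$.
   Context: All graphs are finite, undirected and simple. For a graph $G$, $e_p(G)=\sum_{v\in V(G)} d_G(v)^p$, where $d_G(v)$ is the degree of $v$. A graph is 3-connected if removing fewer than 3 vertices always leaves a connected graph, and minimally 3-connected if it is 3-connected and deleting any edge yields a graph that is not 3-connected. $W_n$ (wheel graph) is obtained by joining every vertex of a cycle $C_{n-1}$ to an extra vertex. $K_{3,n-3}$ is the complete bipartite graph with parts of sizes $3$ and $n-3$.
   Formalization: The equality clause is corrected: equality holds iff G is isomorphic to whichever of W_n, K_{3,n-3} attains the maximum (either one if tied); as worded it fails, e.g. for p=2, G=W_8, since e_2(W_8)=112<120=e_2(K_{3,5}). *)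

theory Defs
  imports "Graph_Theory.Graph_Theory"
begin

text \<open>
  Finite simple undirected graphs are modelled by the locale \<open>pair_graph\<close>: finite, loop-free,
  symmetric digraphs whose arcs are pairs of vertices. An undirected edge is thus a pair of
  opposite arcs, and the degree of a vertex is its out-degree.
\<close>

definition degree_power_sum :: "nat \<Rightarrow> 'a pair_pre_digraph \<Rightarrow> nat" where
  "degree_power_sum p G = (\<Sum>v\<in>pverts G. out_degree (with_proj G) v ^ p)"

definition three_connected :: "'a pair_pre_digraph \<Rightarrow> bool" where
  "three_connected G \<longleftrightarrow>
     (\<forall>S. S \<subseteq> pverts G \<and> finite S \<and> card S < 3 \<longrightarrow> connected (with_proj G \<restriction> (pverts G - S)))"

definition delete_edge :: "'a pair_pre_digraph \<Rightarrow> 'a \<times> 'a \<Rightarrow> 'a pair_pre_digraph" where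
  "delete_edge G e = \<lparr>pverts = pverts G, parcs = parcs G - {e, prod.swap e}\<rparr>"

definition minimally_three_connected :: "'a pair_pre_digraph \<Rightarrow> bool" where
  "minimally_three_connected G \<longleftrightarrow>
     three_connected G \<and> (\<forall>e\<in>parcs G. \<not> three_connected (delete_edge G e))"

text \<open>The cycle, meaningful for \<open>m \<ge> 3\<close>.\<close>

definition cycle_graph :: "nat \<Rightarrow> nat pair_pre_digraph" where
  "cycle_graph m = \<lparr>pverts = {..<m},
     parcs = {(i, j). i < m \<and> j < m \<and> (j = Suc i mod m \<or> i = Suc j mod m)}\<rparr>"

text \<open>The wheel on \<open>n \<ge> 4\<close> vertices in total; the hub is the vertex \<open>n - 1\<close>.\<close>

definition wheel_graph :: "nat \<Rightarrow> nat pair_pre_digraph" where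
  "wheel_graph n = (let R = cycle_graph (n - 1) in
     \<lparr>pverts = insert (n - 1) (pverts R),
      parcs = parcs R \<union> {n - 1} \<times> pverts R \<union> pverts R \<times> {n - 1}\<rparr>)"

definition complete_bipartite_graph :: "nat \<Rightarrow> nat \<Rightarrow> nat pair_pre_digraph" where
  "complete_bipartite_graph a b = \<lparr>pverts = {..<a + b},
     parcs = {..<a} \<times> {a..<a + b} \<union> {a..<a + b} \<times> {..<a}\<rparr>"

lemma complete_bipartite_digraph_complete_bipartite_graph:
  "complete_bipartite_digraph a b (with_proj (complete_bipartite_graph a b))"
  unfolding complete_bipartite_digraph_pair_def
  by (intro conjI, simp add: complete_bipartite_graph_def,
      rule exI[of _ "{..<a}"], rule exI[of _ "{a..<a + b}"])
    (auto simp: complete_bipartite_graph_def)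

lemma pair_graph_wheel_graph:
  assumes "n \<ge> 4"
  shows "pair_graph (wheel_graph n)"
proof
  let ?m = "n - 1"
  have suc: "Suc i mod ?m \<noteq> i" if "i < ?m" for i
    using that assms by (cases "Suc i = ?m") auto
  show "fst e \<in> pverts (wheel_graph n)" "snd e \<in> pverts (wheel_graph n)"
    if "e \<in> parcs (wheel_graph n)" for e
    using that by (auto simp: wheel_graph_def cycle_graph_def Let_def)
  show fin: "finite (pverts (wheel_graph n))"
    by (simp add: wheel_graph_def cycle_graph_def Let_def)
  show "finite (parcs (wheel_graph n))"
  proof (rule finite_subset)
    show "parcs (wheel_graph n) \<subseteq> pverts (wheel_graph n) \<times> pverts (wheel_graph n)"
      by (auto simp: wheel_graph_def cycle_graph_def Let_def)
  qed (simp add: fin)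
  show "fst e \<noteq> snd e" if "e \<in> parcs (wheel_graph n)" for e
  proof
    assume "fst e = snd e"
    with that obtain i where "e = (i, i)" "(i, i) \<in> parcs (wheel_graph n)"
      by (metis prod.collapse)
    then show False
      using suc[of i] by (auto simp: wheel_graph_def cycle_graph_def Let_def)
  qed
  show "symmetric (with_proj (wheel_graph n))"
    by (auto simp: symmetric_def wheel_graph_def cycle_graph_def Let_def intro!: symI)
qed

lemma out_degree_with_proj:
  "out_degree (with_proj G) v = card {w. (v, w) \<in> parcs G}"
proof -
  have "out_arcs (with_proj G) v = Pair v ` {w. (v, w) \<in> parcs G}"
    by (auto simp: out_arcs_def)
  then show ?thesis
    by (simp add: out_degree_def card_image inj_on_def)
qed

lemma degree_power_sum_complete_bipartite_graph:
  "degree_power_sum p (complete_bipartite_graph a b) = a * b ^ p + b * a ^ p"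
proof -
  have "out_degree (with_proj (complete_bipartite_graph a b)) v = (if v < a then b else a)"
    if "v < a + b" for v
  proof -
    have "{w. (v, w) \<in> parcs (complete_bipartite_graph a b)}
        = (if v < a then {a..<a + b} else {..<a})"
      using that by (auto simp: complete_bipartite_graph_def)
    then show ?thesis by (simp add: out_degree_with_proj)
  qed
  then have "degree_power_sum p (complete_bipartite_graph a b)
      = (\<Sum>v<a + b. (if v < a then b else a) ^ p)"
    by (simp add: degree_power_sum_def complete_bipartite_graph_def)
  also have "\<dots> = (\<Sum>v<a. b ^ p) + (\<Sum>v = a..<a + b. a ^ p)"
    by (simp add: lessThan_atLeast0 sum.atLeastLessThan_concat[of 0 a "a + b", symmetric])
  finally show ?thesis by simp
qed

lemma degree_power_sum_wheel_graph:
  assumes "n \<ge> 4"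
  shows "degree_power_sum p (wheel_graph n) = (n - 1) ^ p + (n - 1) * 3 ^ p"
proof -
  define m where "m = n - 1"
  have m: "m \<ge> 3" using assms by (simp add: m_def)
  have hub: "out_degree (with_proj (wheel_graph n)) m = m"
  proof -
    have "{w. (m, w) \<in> parcs (wheel_graph n)} = {..<m}"
      by (auto simp: wheel_graph_def cycle_graph_def Let_def m_def)
    then show ?thesis by (simp add: out_degree_with_proj)
  qed
  have rim: "out_degree (with_proj (wheel_graph n)) v = 3" if v: "v < m" for v
  proof -
    define s where "s = (if Suc v = m then 0 else Suc v)"
    define q where "q = (if v = 0 then m - 1 else v - 1)"
    have "Suc v mod m = s"
      using v by (auto simp: s_def)
    moreover have "w < m \<and> v = Suc w mod m \<longleftrightarrow> w = q" for w
      using v m by (cases "Suc w = m") (auto simp: q_def dest: dvd_imp_le)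
    moreover have "s < m"
      using v m by (auto simp: s_def)
    moreover have "(v, w) \<in> parcs (wheel_graph n) \<longleftrightarrow>
        w = m \<or> (w < m \<and> w = Suc v mod m) \<or> (w < m \<and> v = Suc w mod m)" for w
      using v by (auto simp: wheel_graph_def cycle_graph_def Let_def m_def)
    ultimately have "{w. (v, w) \<in> parcs (wheel_graph n)} = {m, s, q}"
      by auto
    moreover have "card {m, s, q} = 3"
      using v m by (auto simp: s_def q_def card_insert_if)
    ultimately show ?thesis by (simp add: out_degree_with_proj)
  qed
  have "pverts (wheel_graph n) = insert m {..<m}"
    by (simp add: wheel_graph_def cycle_graph_def Let_def m_def)
  then have "degree_power_sum p (wheel_graph n) = m ^ p + (\<Sum>v<m. 3 ^ p)"
    by (simp add: degree_power_sum_def hub rim)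
  then show ?thesis by (simp add: m_def)
qed

end

theory Submission
  imports Defs
begin

text \<open>
  Let \<open>F\<close> be the set of vertices of degree at least 4. In a minimally 3-connected graph every edge
  \<open>xy\<close> becomes a bridge after removing some set of at most two vertices. Uncrossing two such
  separations at a common vertex, one with a smallest side, shows that \<open>F\<close> induces a forest.

  If some vertex has degree \<open>n - 1\<close>, the separations force all other degrees to be 3, and the graph
  is a wheel. If some vertex has degree \<open>n - 2\<close>, they force at most one further vertex into \<open>F\<close>, of
  degree 4, and by convexity the power sum is below that of the wheel. Otherwise all degrees are at
  most \<open>n - 3\<close>. For \<open>card F \<le> 3\<close> the bound by the complete bipartite graph is immediate, and equality
  makes \<open>F\<close> three independent vertices of degree \<open>n - 3\<close>. For \<open>card F \<ge> 4\<close> the forest property gives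
  \<open>\<Sum>v\<in>F. deg v - 3 \<le> 3 * (n - 6)\<close>, and convexity of \<open>x ^ p\<close> between 3 and \<open>n - 3\<close> gives a strict
  inequality.
\<close>

section \<open>Convexity of powers\<close>

text \<open>Strict convexity as a comparison of chord slopes from \<open>a\<close>. Factoring out
  \<open>d - a\<close> and \<open>m - a\<close> leaves two sums that compare term by term, strictly
  at index 1, which occurs because \<open>p > 1\<close>.\<close>

lemma power_diff_chord_less:
  fixes a d m :: int
  assumes "0 < a" "a < d" "d < m" "p > 1"
  shows "(m - a) * (d ^ p - a ^ p) < (d - a) * (m ^ p - a ^ p)"
proof -
  have "(\<Sum>i<p. a ^ (p - Suc i) * d ^ i) < (\<Sum>i<p. a ^ (p - Suc i) * m ^ i)"
  proof (rule sum_strict_mono_ex1)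
    show "\<forall>i\<in>{..<p}. a ^ (p - Suc i) * d ^ i \<le> a ^ (p - Suc i) * m ^ i"
      using assms by (intro ballI mult_left_mono power_mono) auto
    show "\<exists>i\<in>{..<p}. a ^ (p - Suc i) * d ^ i < a ^ (p - Suc i) * m ^ i"
      using assms by (intro bexI[of _ 1]) auto
  qed simp
  then have "((m - a) * (d - a)) * (\<Sum>i<p. a ^ (p - Suc i) * d ^ i)
      < ((m - a) * (d - a)) * (\<Sum>i<p. a ^ (p - Suc i) * m ^ i)"
    using assms by (intro mult_strict_left_mono) auto
  then show ?thesis
    unfolding power_diff_sumr2[of d p a] power_diff_sumr2[of m p a] by (simp add: ac_simps)
qed

text \<open>The same factorisation, with factor 1 in front; the sums differ strictly at index
  0.\<close>

lemma power_step_less: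
  fixes x y :: int
  assumes "0 < x" "x < y" "p > 1"
  shows "(x + 1) ^ p - x ^ p < (y + 1) ^ p - y ^ p"
proof -
  have "(\<Sum>i<p. x ^ (p - Suc i) * (x + 1) ^ i) < (\<Sum>i<p. y ^ (p - Suc i) * (y + 1) ^ i)"
  proof (rule sum_strict_mono_ex1)
    show "\<forall>i\<in>{..<p}. x ^ (p - Suc i) * (x + 1) ^ i \<le> y ^ (p - Suc i) * (y + 1) ^ i"
      using assms by (intro ballI mult_mono power_mono) auto
    show "\<exists>i\<in>{..<p}. x ^ (p - Suc i) * (x + 1) ^ i < y ^ (p - Suc i) * (y + 1) ^ i"
      using assms by (intro bexI[of _ 0]) (auto intro!: power_strict_mono)
  qed simp
  then show ?thesis
    using power_diff_sumr2[of "x + 1" p x] power_diff_sumr2[of "y + 1" p y] by simp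
qed

section \<open>Separations in minimally 3-connected graphs\<close>

text \<open>The hypotheses in cut form: \<open>edge_across\<close> is 3-connectivity, and
  \<open>edge_critical\<close> is minimality, where deleting the edge \<open>x y\<close> leaves a
  cut that only this edge had crossed.\<close>

locale min_3_connected_graph =
  fixes V :: "'a set" and E :: "('a \<times> 'a) set"
  assumes finite_V: "finite V"
    and E_subset: "E \<subseteq> V \<times> V"
    and E_sym: "(x, y) \<in> E \<Longrightarrow> (y, x) \<in> E"
    and E_irrefl: "(x, x) \<notin> E"
    and card_V: "card V \<ge> 8"
    and edge_across: "\<lbrakk>V = A \<union> B \<union> T; A \<inter> B = {}; A \<noteq> {}; B \<noteq> {}; A \<inter> T = {}; B \<inter> T = {}; card T \<le> 2\<rbrakk>
      \<Longrightarrow> \<exists>a\<in>A. \<exists>b\<in>B. (a, b) \<in> E"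
    and edge_critical: "(x, y) \<in> E \<Longrightarrow>
      \<exists>A B T. V = A \<union> B \<union> T \<and> A \<inter> B = {} \<and> A \<inter> T = {} \<and> B \<inter> T = {} \<and> card T \<le> 2 \<and>
        x \<in> A \<and> y \<in> B \<and> (\<forall>a\<in>A. \<forall>b\<in>B. (a, b) \<in> E \<longrightarrow> a = x \<and> b = y)"
begin

definition nbrs :: "'a \<Rightarrow> 'a set" where
  "nbrs v = {w. (v, w) \<in> E}"

definition deg :: "'a \<Rightarrow> nat" where
  "deg v = card (nbrs v)"

text \<open>The set \<open>F\<close> of the overview.\<close>

definition big :: "'a set" where
  "big = {v \<in> V. deg v \<ge> 4}"

text \<open>A mixed separation: \<open>T\<close> together with the one edge \<open>x y\<close> cuts
  \<open>A\<close> from \<open>B\<close>. That \<open>x y\<close> is an edge is not stated; it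
  follows from \<open>edge_across\<close>.\<close>

definition sep :: "'a \<Rightarrow> 'a \<Rightarrow> 'a set \<Rightarrow> 'a set \<Rightarrow> 'a set \<Rightarrow> bool" where
  "sep x y A B T \<longleftrightarrow> V = A \<union> B \<union> T \<and> A \<inter> B = {} \<and> A \<inter> T = {} \<and> B \<inter> T = {} \<and> card T \<le> 2 \<and>
    x \<in> A \<and> y \<in> B \<and> (\<forall>a\<in>A. \<forall>b\<in>B. (a, b) \<in> E \<longrightarrow> a = x \<and> b = y)"

lemma in_nbrs [simp]: "w \<in> nbrs v \<longleftrightarrow> (v, w) \<in> E"
  by (simp add: nbrs_def)

lemma E_in_V: "(x, y) \<in> E \<Longrightarrow> x \<in> V \<and> y \<in> V"
  using E_subset by blast

lemma nbrs_subset: "nbrs v \<subseteq> V"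
  using E_in_V by (auto simp: nbrs_def)

lemma finite_sub: "X \<subseteq> V \<Longrightarrow> finite X"
  using finite_V finite_subset by blast

lemma finite_nbrs: "finite (nbrs v)"
  using nbrs_subset finite_sub by blast

lemma sep_exists: "(x, y) \<in> E \<Longrightarrow> \<exists>A B T. sep x y A B T"
  unfolding sep_def by (rule edge_critical)

lemma sep_sym: "sep x y A B T \<Longrightarrow> sep y x B A T"
  unfolding sep_def using E_sym by blast

lemma sepI:
  assumes "X \<subseteq> V" "N \<subseteq> V" "X \<inter> N = {}" "x \<in> X" "y \<in> V - X - N" "card N \<le> 2"
    and out: "\<And>v w. v \<in> X \<Longrightarrow> (v, w) \<in> E \<Longrightarrow> w \<in> X \<union> N \<or> (v = x \<and> w = y)"
  shows "sep x y X (V - X - N) N"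
  unfolding sep_def
proof (intro conjI)
  show "V = X \<union> (V - X - N) \<union> N" using assms(1,2) by blast
  show "\<forall>a\<in>X. \<forall>b\<in>V - X - N. (a, b) \<in> E \<longrightarrow> a = x \<and> b = y" using out by blast
qed (use assms in auto)

text \<open>Otherwise \<open>N\<close> would be a separator of at most two vertices between
  \<open>X\<close> and the non-empty rest.\<close>

lemma boundary_card:
  assumes "X \<subseteq> V" "X \<noteq> {}" "N \<subseteq> V" "X \<inter> N = {}" "X \<union> N \<noteq> V"
    and "\<And>v w. v \<in> X \<Longrightarrow> (v, w) \<in> E \<Longrightarrow> w \<in> X \<union> N"
  shows "card N \<ge> 3"
proof (rule ccontr)
  assume "\<not> card N \<ge> 3"
  then have "\<exists>a\<in>X. \<exists>b\<in>V - X - N. (a, b) \<in> E"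
    using assms by (intro edge_across[where T = N]) auto
  then show False using assms(6) by blast
qed

lemma deg_le_cover: "nbrs v \<subseteq> X \<Longrightarrow> finite X \<Longrightarrow> deg v \<le> card X"
  unfolding deg_def by (rule card_mono)

text \<open>The neighbourhood is the boundary of \<open>{v}\<close>, unless it is everything else,
  and then it has at least seven elements.\<close>

lemma deg_ge_3:
  assumes "v \<in> V"
  shows "deg v \<ge> 3"
proof (cases "insert v (nbrs v) = V")
  case True
  then have "card V \<le> Suc (deg v)"
    unfolding deg_def by (metis card_insert_if finite_nbrs le_SucI order_refl)
  then show ?thesis using card_V by linarith
next
  case False
  then show ?thesis
    unfolding deg_def using boundary_card[of "{v}" "nbrs v"] assms nbrs_subset E_irrefl by auto
qed

lemma sep_nbrs:
  assumes "sep x y A B T"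
  shows "nbrs x \<subseteq> insert y ((A - {x}) \<union> T)"
    and "\<And>v. v \<in> A \<Longrightarrow> v \<noteq> x \<Longrightarrow> nbrs v \<subseteq> (A - {v}) \<union> T"
proof -
  have V: "V = A \<union> B \<union> T" and e: "\<And>a b. a \<in> A \<Longrightarrow> b \<in> B \<Longrightarrow> (a, b) \<in> E \<Longrightarrow> a = x \<and> b = y" and "x \<in> A"
    using assms unfolding sep_def by blast+
  have *: "w \<in> A \<or> w \<in> B \<or> w \<in> T" "w \<noteq> v" if "(v, w) \<in> E" for v w
    using E_in_V[OF that] that E_irrefl V by auto
  show "nbrs x \<subseteq> insert y ((A - {x}) \<union> T)"
    using * e[OF \<open>x \<in> A\<close>] by fastforce
  show "nbrs v \<subseteq> (A - {v}) \<union> T" if "v \<in> A" "v \<noteq> x" for v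
    using * e[OF that(1)] that(2) by fastforce
qed

text \<open>The neighbours of \<open>x\<close> are among \<open>y\<close>, the rest of
  \<open>A\<close>, and \<open>T\<close>, so 4 is at most \<open>card A + card T\<close>. With
  \<open>card T\<close> at most 2, the case \<open>card A = 2\<close> is tight and every candidate
  is a neighbour.\<close>

lemma sep_side_not_singleton:
  assumes s: "sep x y A B T" and d: "deg x \<ge> 4"
  shows "card A \<ge> 2"
    and "card A = 2 \<Longrightarrow> T \<subseteq> nbrs x \<and> card T = 2"
proof -
  have fin: "finite A" "finite T" "card T \<le> 2" "x \<in> A"
    using s finite_sub unfolding sep_def by auto
  have sub: "nbrs x \<subseteq> insert y ((A - {x}) \<union> T)"
    by (rule sep_nbrs(1)[OF s])
  have fin': "finite (insert y ((A - {x}) \<union> T))"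
    using fin by auto
  have c: "card (insert y ((A - {x}) \<union> T)) \<le> Suc (card A - 1 + card T)"
    using card_Un_le[of "A - {x}" T] fin by (auto simp: card_insert_if)
  have d': "4 \<le> card (insert y ((A - {x}) \<union> T))"
    using deg_le_cover[OF sub fin'] d by linarith
  have pos: "card A > 0" using fin card_gt_0_iff by blast
  show "card A \<ge> 2" using c d' fin(3) pos by linarith
  show "T \<subseteq> nbrs x \<and> card T = 2" if a: "card A = 2"
  proof
    have "nbrs x = insert y ((A - {x}) \<union> T)"
      using d c a fin(3) unfolding deg_def by (intro card_seteq fin' sub) linarith
    then show "T \<subseteq> nbrs x" by blast
    show "card T = 2" using c d' a fin(3) by linarith
  qed
qed

text \<open>Mader's theorem that \<open>big\<close> induces a forest, phrased without cycles.\<close>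

lemma no_dense_big_subset:
  assumes C: "C \<subseteq> big" "C \<noteq> {}"
    and two: "\<And>x. x \<in> C \<Longrightarrow> \<exists>y\<in>C. \<exists>z\<in>C. y \<noteq> z \<and> (x, y) \<in> E \<and> (x, z) \<in> E"
  shows False
proof -
  \<comment> \<open>\<open>card A\<close> is minimised over all edges inside \<open>C\<close> in
    both orientations, so by \<open>sep_sym\<close> the side \<open>B\<close> is no smaller than
    \<open>A\<close>.\<close>
  define P where "P = (\<lambda>(x, y, A, B, T). x \<in> C \<and> y \<in> C \<and> sep x y A B T)"
  obtain x0 where "x0 \<in> C" using C by blast
  then obtain y0 where "y0 \<in> C" "(x0, y0) \<in> E" using two by blast
  then obtain A0 B0 T0 where "P (x0, y0, A0, B0, T0)"
    using sep_exists \<open>x0 \<in> C\<close> unfolding P_def by fastforce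
  from ex_has_least_nat[of P, OF this, where m = "\<lambda>(x, y, A, B, T). card A"]
  obtain q where q: "P q"
    and least_q: "\<And>q'. P q' \<Longrightarrow> (\<lambda>(x, y, A, B, T). card A) q \<le> (\<lambda>(x, y, A, B, T). card A) q'"
    by blast
  obtain x y A B T where q_eq: "q = (x, y, A, B, T)"
    by (cases q) auto
  have xy: "x \<in> C" "y \<in> C" and s: "sep x y A B T"
    using q unfolding P_def q_eq by auto
  have least: "card A \<le> card A'" if "x' \<in> C" "y' \<in> C" "sep x' y' A' B' T'" for x' y' A' B' T'
    using least_q[of "(x', y', A', B', T')"] that unfolding P_def q_eq by simp
  have dx: "deg x \<ge> 4" using xy C unfolding big_def by auto
  \<comment> \<open>A second edge at \<open>x\<close> inside \<open>C\<close> supplies the crossing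
    separation, oriented so that \<open>x\<close> lies in both \<open>A\<close> and
    \<open>A'\<close>.\<close>
  obtain z where z: "z \<in> C" "z \<noteq> y" "(x, z) \<in> E" using two[OF xy(1)] by metis
  obtain A' B' T' where s': "sep x z A' B' T'" using sep_exists z by blast
  have p: "V = A \<union> B \<union> T" "A \<inter> B = {}" "A \<inter> T = {}" "B \<inter> T = {}" "card T \<le> 2" "x \<in> A" "y \<in> B"
    and e: "\<And>a b. a \<in> A \<Longrightarrow> b \<in> B \<Longrightarrow> (a, b) \<in> E \<Longrightarrow> a = x \<and> b = y"
    using s unfolding sep_def by blast+
  have p': "V = A' \<union> B' \<union> T'" "A' \<inter> B' = {}" "A' \<inter> T' = {}" "B' \<inter> T' = {}" "card T' \<le> 2" "x \<in> A'" "z \<in> B'"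
    and e': "\<And>a b. a \<in> A' \<Longrightarrow> b \<in> B' \<Longrightarrow> (a, b) \<in> E \<Longrightarrow> a = x \<and> b = z"
    using s' unfolding sep_def by blast+
  have er: "b = y \<and> a = x" if "b \<in> B" "a \<in> A" "(b, a) \<in> E" for a b
    using e[OF that(2,1)] E_sym that(3) by blast
  have er': "b = z \<and> a = x" if "b \<in> B'" "a \<in> A'" "(b, a) \<in> E" for a b
    using e'[OF that(2,1)] E_sym that(3) by blast
  have fin: "finite A" "finite B" "finite T" "finite A'" "finite B'" "finite T'"
    using finite_sub p(1) p'(1) by auto
  \<comment> \<open>The two separations are uncrossed; \<open>N1\<close> to \<open>N4\<close> are the boundaries of the four corners.
    Opposite corners have boundaries of total size at most 4, while minimality of \<open>card A\<close>
    and 3-connectivity bound them from below.\<close>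
  define N1 where "N1 = (T' \<inter> A) \<union> (T \<inter> T') \<union> (T \<inter> A')"
  define N2 where "N2 = (T' \<inter> B) \<union> (T \<inter> T') \<union> (T \<inter> B')"
  define N3 where "N3 = (T' \<inter> A) \<union> (T \<inter> T') \<union> (T \<inter> B')"
  define N4 where "N4 = (T' \<inter> B) \<union> (T \<inter> T') \<union> (T \<inter> A')"
  have cT: "card T = card (T \<inter> A') + card (T \<inter> T') + card (T \<inter> B')"
  proof -
    have "T = (T \<inter> A') \<union> (T \<inter> T') \<union> (T \<inter> B')" using p(1) p'(1) by blast
    also have "card \<dots> = card (T \<inter> A') + card (T \<inter> T') + card (T \<inter> B')"
      using fin p' by (subst card_Un_disjoint, auto)+
    finally show ?thesis .
  qed
  have cT': "card T' = card (T' \<inter> A) + card (T \<inter> T') + card (T' \<inter> B)"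
  proof -
    have "T' = (T' \<inter> A) \<union> (T \<inter> T') \<union> (T' \<inter> B)" using p(1) p'(1) by blast
    also have "card \<dots> = card (T' \<inter> A) + card (T \<inter> T') + card (T' \<inter> B)"
      using fin p by (subst card_Un_disjoint, auto)+
    finally show ?thesis .
  qed
  have N: "card N1 \<le> card (T' \<inter> A) + card (T \<inter> T') + card (T \<inter> A')"
    "card N2 \<le> card (T' \<inter> B) + card (T \<inter> T') + card (T \<inter> B')"
    "card N3 \<le> card (T' \<inter> A) + card (T \<inter> T') + card (T \<inter> B')"
    "card N4 \<le> card (T' \<inter> B) + card (T \<inter> T') + card (T \<inter> A')"
    unfolding N1_def N2_def N3_def N4_def by (meson card_Un_le add_le_mono1 order_trans)+
  have NV: "N1 \<subseteq> V" "N2 \<subseteq> V" "N3 \<subseteq> V" "N4 \<subseteq> V"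
    unfolding N1_def N2_def N3_def N4_def using p(1) by auto
  have inV: "x \<in> V" "y \<in> V" "z \<in> V" and AV: "A \<subseteq> V" and BV: "B \<subseteq> V"
    using p(1,6,7) p'(1,7) by auto
  have cover: "v \<in> A \<or> v \<in> B \<or> v \<in> T" "v \<in> A' \<or> v \<in> B' \<or> v \<in> T'" if "v \<in> V" for v
    using that p(1) p'(1) by auto
  have xB: "x \<notin> B" "x \<notin> T" "x \<notin> B'" "x \<notin> T'" "y \<notin> A" "y \<notin> T" "z \<notin> A'" "z \<notin> T'"
    using p p' by auto
  have exy: "(x, y) \<in> E"
  proof (rule ccontr)
    assume "(x, y) \<notin> E"
    then have "\<not> (\<exists>a\<in>A. \<exists>b\<in>B. (a, b) \<in> E)" using e by blast
    moreover have "A \<noteq> {}" "B \<noteq> {}" using p(6,7) by auto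
    ultimately show False using edge_across[OF p(1,2) _ _ p(3-5)] by blast
  qed
  \<comment> \<open>Each critical edge is the only one across its own separation, so neither of them
    ends in the corner \<open>B \<inter> B'\<close>.\<close>
  have yB': "y \<notin> B'" using e'[OF p'(6) _ exy] z by blast
  have zB: "z \<notin> B" using e[OF p(6) _ z(3)] z by blast

  have loc: "w \<in> A \<or> w \<in> B \<or> w \<in> T" "w \<in> A' \<or> w \<in> B' \<or> w \<in> T'" if "(v, w) \<in> E" for v w
    using cover E_in_V[OF that] by auto
  \<comment> \<open>Both critical edges leave the corner \<open>A \<inter> A'\<close> at
    \<open>x\<close>. If the corner is just \<open>{x}\<close>, the degree of \<open>x\<close> gives
    the bound; otherwise moving \<open>x\<close> into the boundary gives an ordinary
    separator.\<close>
  have n1: "card N1 \<ge> 2"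
  proof (rule ccontr)
    assume "\<not> ?thesis"
    then have le: "card N1 \<le> 1" by linarith
    have out: "w \<in> (A \<inter> A') \<union> N1 \<or> v = x" if "v \<in> A \<inter> A'" "(v, w) \<in> E" for v w
      using that e[of v w] e'[of v w] loc[OF that(2)] unfolding N1_def by blast
    have outx: "w \<in> (A \<inter> A') \<union> N1 \<union> {y, z}" if "(x, w) \<in> E" for w
      using that e[of x w] e'[of x w] loc[OF that] p(6) p'(6) unfolding N1_def by blast
    show False
    proof (cases "A \<inter> A' = {x}")
      case True
      have "nbrs x \<subseteq> insert y (insert z N1)"
      proof
        fix w assume "w \<in> nbrs x"
        then show "w \<in> insert y (insert z N1)" using outx[of w] E_irrefl[of x] True by auto
      qed
      then have "deg x \<le> card (insert y (insert z N1))"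
        using finite_sub[OF NV(1)] by (intro deg_le_cover) auto
      also have "\<dots> \<le> 3" using le finite_sub[OF NV(1)] by (auto simp: card_insert_if)
      finally show False using dx by linarith
    next
      case False
      have "card (insert x N1) \<ge> 3"
      proof (rule boundary_card[of "A \<inter> A' - {x}"])
        show "A \<inter> A' - {x} \<noteq> {}" using False p(6) p'(6) by blast
        show "(A \<inter> A' - {x}) \<inter> insert x N1 = {}" using p(2-4) p'(2-4) unfolding N1_def by blast
        have "y \<notin> (A \<inter> A' - {x}) \<union> insert x N1" using xB p(6,7) unfolding N1_def by blast
        then show "(A \<inter> A' - {x}) \<union> insert x N1 \<noteq> V" using inV by blast
        show "A \<inter> A' - {x} \<subseteq> V" "insert x N1 \<subseteq> V" using NV AV inV by auto
        show "w \<in> A \<inter> A' - {x} \<union> insert x N1" if "v \<in> A \<inter> A' - {x}" "(v, w) \<in> E" for v w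
          using out[of v w] that by blast
      qed
      then show False using le finite_sub[OF NV(1)] by (auto simp: card_insert_if split: if_splits)
    qed
  qed
  have BB: "B \<inter> B' = {}"
  proof (rule ccontr)
    assume ne: "B \<inter> B' \<noteq> {}"
    have "card N2 \<ge> 3"
    proof (rule boundary_card[OF _ ne NV(2)])
      show "B \<inter> B' \<subseteq> V" "(B \<inter> B') \<inter> N2 = {}" using BV p(2-4) p'(2-4) unfolding N2_def by auto
      have "x \<notin> B \<inter> B' \<union> N2" using xB unfolding N2_def by blast
      then show "B \<inter> B' \<union> N2 \<noteq> V" using inV by blast
      show "w \<in> B \<inter> B' \<union> N2" if "v \<in> B \<inter> B'" "(v, w) \<in> E" for v w
        using that er[of v w] er'[of v w] yB' zB loc[OF that(2)] unfolding N2_def by blast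
    qed
    then show False using n1 N cT cT' p(5) p'(5) by linarith
  qed
  have AB: "A \<inter> B' = {}"
  proof (rule ccontr)
    assume ne: "A \<inter> B' \<noteq> {}"
    have out: "w \<in> A \<inter> B' \<union> N3 \<or> (v = z \<and> w = x)" if "v \<in> A \<inter> B'" "(v, w) \<in> E" for v w
      using that e[of v w] er'[of v w] xB loc[OF that(2)] unfolding N3_def by blast
    have disj: "A \<inter> B' \<inter> N3 = {}" using p(2-4) p'(2-4) unfolding N3_def by blast
    have xo: "x \<notin> A \<inter> B' \<union> N3" using xB unfolding N3_def by blast
    \<comment> \<open>If \<open>z\<close> is in \<open>A\<close>, a smaller \<open>N3\<close> would
      make this corner a side of a separation for the edge \<open>z x\<close>, smaller than
      \<open>A\<close> because it misses \<open>x\<close>. If not, no critical edge leaves the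
      corner.\<close>
    have n3: "card N3 \<ge> 3"
    proof (cases "z \<in> A")
      case True
      show ?thesis
      proof (rule ccontr)
        assume "\<not> card N3 \<ge> 3"
        then have "sep z x (A \<inter> B') (V - A \<inter> B' - N3) N3"
          using AV NV(3) disj True p'(7) inV(1) xo out by (intro sepI) auto
        then have "card A \<le> card (A \<inter> B')" using least z xy by blast
        moreover have "card (A \<inter> B') < card A"
          using fin p(6) xB by (intro psubset_card_mono) auto
        ultimately show False by linarith
      qed
    next
      case False
      show ?thesis
      proof (rule boundary_card[OF _ ne NV(3) disj])
        show "A \<inter> B' \<subseteq> V" using AV by blast
        show "A \<inter> B' \<union> N3 \<noteq> V" using xo inV by blast
        show "w \<in> A \<inter> B' \<union> N3" if "v \<in> A \<inter> B'" "(v, w) \<in> E" for v w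
          using out that False by blast
      qed
    qed
    \<comment> \<open>Only the edge from \<open>y\<close> to \<open>x\<close> can escape the
      boundary \<open>N4\<close>, so adding \<open>x\<close> to it suffices, and \<open>N3\<close>
      and \<open>N4\<close> together would exceed 4.\<close>
    have BA: "B \<inter> A' = {}"
    proof (rule ccontr)
      assume ne: "B \<inter> A' \<noteq> {}"
      have "card (insert x N4) \<ge> 3"
      proof (rule boundary_card[OF _ ne])
        show "B \<inter> A' \<subseteq> V" "insert x N4 \<subseteq> V" using BV inV NV by auto
        show "B \<inter> A' \<inter> insert x N4 = {}" using p(2-4) p'(2-4) xB unfolding N4_def by blast
        have "z \<notin> B \<inter> A' \<union> insert x N4" using xB p'(7) zB unfolding N4_def by blast
        then show "B \<inter> A' \<union> insert x N4 \<noteq> V" using inV by blast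
        show "w \<in> B \<inter> A' \<union> insert x N4" if "v \<in> B \<inter> A'" "(v, w) \<in> E" for v w
          using that er[of v w] e'[of v w] xB loc[OF that(2)] unfolding N4_def by blast
      qed
      then have "card N4 \<ge> 2" using finite_sub[OF NV(4)] by (auto simp: card_insert_if split: if_splits)
      then show False using n3 N cT cT' p(5) p'(5) by linarith
    qed
    \<comment> \<open>Now \<open>A\<close> and \<open>B\<close> have at most two vertices each, so
      the graph would have at most six.\<close>
    have "B \<subseteq> T'" using BA BB BV cover(2) by blast
    then have "card B \<le> 2" using card_mono[OF fin(6)] p'(5) by (meson order_trans)
    moreover have "card A \<le> card B" using least[OF xy(2,1) sep_sym[OF s]] .
    moreover have "card V \<le> card A + card B + card T"
      unfolding p(1) by (meson card_Un_le add_le_mono1 order_trans)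
    ultimately show False using card_V p(5) by linarith
  qed
  \<comment> \<open>What remains is \<open>B'\<close> inside \<open>T\<close>. Minimality makes
    everything tight: \<open>B' = T\<close> has two elements, all adjacent to \<open>x\<close>,
    although \<open>z\<close> is the only neighbour of \<open>x\<close> in
    \<open>B'\<close>.\<close>
  have "B' \<subseteq> V" using p'(1) by auto
  then have B'T: "B' \<subseteq> T" using AB BB cover(1) by blast
  have "card A \<le> card B'" using least[OF z(1) xy(1) sep_sym[OF s']] .
  moreover have "card B' \<le> card T" using card_mono[OF fin(3) B'T] .
  ultimately have cA: "card A = 2" and cB': "card B' = card T"
    using sep_side_not_singleton(1)[OF s dx] p(5) by linarith+
  have Tx: "T \<subseteq> nbrs x" "card T = 2" using sep_side_not_singleton(2)[OF s dx cA] by auto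
  have "B' = T" using card_subset_eq[OF fin(3) B'T cB'] .
  then have "T \<subseteq> {z}" using Tx(1) e'[OF p'(6)] by auto
  then show False using Tx(2) card_mono[of "{z}" T] by auto
qed

section \<open>Degree sums\<close>

text \<open>Twice the number of edges induced on \<open>U\<close>.\<close>

definition degsum_within :: "'a set \<Rightarrow> nat" where
  "degsum_within U = (\<Sum>v\<in>U. card (nbrs v \<inter> U))"

lemma card_nbrs_inter: "finite Y \<Longrightarrow> card (nbrs v \<inter> Y) = (\<Sum>w\<in>Y. of_bool ((v, w) \<in> E))"
  by (simp add: sum_of_bool_eq nbrs_def Int_def conj_commute)

lemma sum_card_nbrs_swap:
  assumes "finite X" "finite Y"
  shows "(\<Sum>v\<in>X. card (nbrs v \<inter> Y)) = (\<Sum>w\<in>Y. card (nbrs w \<inter> X))"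
proof -
  have "(\<Sum>v\<in>X. card (nbrs v \<inter> Y)) = (\<Sum>v\<in>X. \<Sum>w\<in>Y. of_bool ((v, w) \<in> E))"
    using assms by (simp add: card_nbrs_inter)
  also have "\<dots> = (\<Sum>w\<in>Y. \<Sum>v\<in>X. of_bool ((v, w) \<in> E))" by (rule sum.swap)
  also have "\<dots> = (\<Sum>w\<in>Y. \<Sum>v\<in>X. of_bool ((w, v) \<in> E))"
    using E_sym by (intro sum.cong refl arg_cong[where f = of_bool]) blast
  finally show ?thesis using assms by (simp add: card_nbrs_inter)
qed

lemma degsum_within_insert:
  assumes "finite U" "x \<notin> U"
  shows "degsum_within (insert x U) = degsum_within U + 2 * card (nbrs x \<inter> U)"
proof -
  have "card (nbrs v \<inter> insert x U) = card (nbrs v \<inter> U) + card (nbrs v \<inter> {x})" if "v \<in> U" for v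
    using assms by (subst card_Un_disjoint[symmetric]) (auto intro!: arg_cong[where f = card])
  moreover have "nbrs x \<inter> insert x U = nbrs x \<inter> U" using E_irrefl by auto
  ultimately have "degsum_within (insert x U)
      = card (nbrs x \<inter> U) + ((\<Sum>v\<in>U. card (nbrs v \<inter> U)) + (\<Sum>v\<in>U. card (nbrs v \<inter> {x})))"
    unfolding degsum_within_def using assms by (simp add: sum.distrib)
  also have "(\<Sum>v\<in>U. card (nbrs v \<inter> {x})) = card (nbrs x \<inter> U)"
    using sum_card_nbrs_swap[of U "{x}"] assms by simp
  finally show ?thesis unfolding degsum_within_def by simp
qed

lemma big_subset: "big \<subseteq> V"
  unfolding big_def by auto

lemma finite_big: "finite big"
  using finite_sub big_subset by blast

text \<open>The edge bound for forests: \<open>no_dense_big_subset\<close> yields a vertex with at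
  most one neighbour in \<open>C\<close>, and removing it loses at most one edge.\<close>

lemma degsum_within_big:
  assumes "C \<subseteq> big" "C \<noteq> {}"
  shows "degsum_within C + 2 \<le> 2 * card C"
  using assms
proof (induction "card C" arbitrary: C)
  case 0
  then show ?case using finite_subset finite_big by fastforce
next
  case (Suc k)
  have finC: "finite C" using Suc.prems finite_subset finite_big by blast
  obtain x where x: "x \<in> C" and "\<not> (\<exists>y\<in>C. \<exists>z\<in>C. y \<noteq> z \<and> (x, y) \<in> E \<and> (x, z) \<in> E)"
    using no_dense_big_subset[OF Suc.prems] by blast
  then have one: "card (nbrs x \<inter> (C - {x})) \<le> 1"
    using finC card_le_Suc0_iff_eq[of "nbrs x \<inter> (C - {x})"] by force
  have d: "degsum_within C = degsum_within (C - {x}) + 2 * card (nbrs x \<inter> (C - {x}))"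
    using degsum_within_insert[of "C - {x}" x] finC x by (simp add: insert_absorb)
  have k: "card (C - {x}) = k" using Suc.hyps(2) x finC by simp
  show ?case
  proof (cases "C - {x} = {}")
    case True
    have "degsum_within C = 0" unfolding d True by (simp add: degsum_within_def)
    then show ?thesis using Suc.hyps(2) by linarith
  next
    case False
    then have "degsum_within (C - {x}) + 2 \<le> 2 * k"
      using Suc.hyps(1)[of "C - {x}"] Suc.prems k by auto
    then show ?thesis using d one Suc.hyps(2) by linarith
  qed
qed

lemma no_big_triangle:
  assumes "a \<in> big" "b \<in> big" "c \<in> big" "(a, b) \<in> E" "(b, c) \<in> E" "(a, c) \<in> E"
  shows False
proof (rule no_dense_big_subset[of "{a, b, c}"])
  show "{a, b, c} \<subseteq> big" using assms by auto
  have "a \<noteq> b" "b \<noteq> c" "a \<noteq> c" using assms E_irrefl by auto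
  then show "\<exists>y\<in>{a, b, c}. \<exists>z\<in>{a, b, c}. y \<noteq> z \<and> (x, y) \<in> E \<and> (x, z) \<in> E" if "x \<in> {a, b, c}" for x
    using that assms E_sym by blast
qed simp

text \<open>Removing at most two vertices leaves a connected graph, which has at least
  \<open>card W - 1\<close> edges: a subset is grown one vertex at a time along an edge leaving
  it.\<close>

lemma degsum_within_connected:
  assumes W: "W \<subseteq> V" and c: "card (V - W) \<le> 2"
  shows "degsum_within W + 2 \<ge> 2 * card W"
proof -
  have fin: "finite W" using finite_sub W by blast
  have "\<exists>U\<subseteq>W. card U = k \<and> degsum_within U + 2 \<ge> 2 * k" if "k \<le> card W" for k
    using that
  proof (induction k)
    case 0
    then show ?case by (intro exI[of _ "{}"]) auto
  next
    case (Suc k)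
    then obtain U where U: "U \<subseteq> W" "card U = k" "degsum_within U + 2 \<ge> 2 * k" by auto
    have finU: "finite U" using U fin finite_subset by blast
    have ne: "U \<noteq> W" using U Suc by auto
    show ?case
    proof (cases "U = {}")
      case True
      obtain x where "x \<in> W" using True ne by blast
      then show ?thesis using U True by (intro exI[of _ "{x}"]) auto
    next
      case False
      have "\<exists>a\<in>U. \<exists>b\<in>W - U. (a, b) \<in> E"
        using U False ne W c by (intro edge_across[where T = "V - W"]) auto
      then obtain a b where ab: "a \<in> U" "b \<in> W - U" "(a, b) \<in> E" by blast
      then have "a \<in> nbrs b \<inter> U" using E_sym by simp
      then have "card (nbrs b \<inter> U) > 0" using finU card_gt_0_iff by blast
      then have "degsum_within (insert b U) + 2 \<ge> 2 * Suc k"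
        using degsum_within_insert[of U b] U ab finU by auto
      then show ?thesis using U ab finU by (intro exI[of _ "insert b U"]) auto
    qed
  qed
  then obtain U where "U \<subseteq> W" "card U = card W" "degsum_within U + 2 \<ge> 2 * card W" by blast
  then show ?thesis using card_subset_eq[OF fin] by blast
qed

lemma deg_split: "deg v = card (nbrs v \<inter> X) + card (nbrs v - X)"
  unfolding deg_def by (metis card_Int_Diff finite_nbrs)

lemma deg_not_big: "v \<in> V \<Longrightarrow> v \<notin> big \<Longrightarrow> deg v = 3"
  using deg_ge_3 unfolding big_def by fastforce

text \<open>Edges inside \<open>big\<close> obey the forest bound, and each of the other vertices,
  having degree 3, sends at most three edges into \<open>big\<close>.\<close>

lemma sum_deg_big:
  assumes "big \<noteq> {}"
  shows "(\<Sum>v\<in>big. deg v) + card big + 2 \<le> 3 * card V"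
proof -
  have "(\<Sum>v\<in>big. deg v) = (\<Sum>v\<in>big. card (nbrs v \<inter> big) + card (nbrs v \<inter> (V - big)))"
  proof (rule sum.cong[OF refl])
    fix v
    have "nbrs v - big = nbrs v \<inter> (V - big)" using nbrs_subset by blast
    then show "deg v = card (nbrs v \<inter> big) + card (nbrs v \<inter> (V - big))"
      using deg_split[of v big] by simp
  qed
  also have "\<dots> = degsum_within big + (\<Sum>v\<in>V - big. card (nbrs v \<inter> big))"
    unfolding degsum_within_def using sum_card_nbrs_swap[of big "V - big"] finite_V finite_big
    by (simp add: sum.distrib)
  also have "(\<Sum>v\<in>V - big. card (nbrs v \<inter> big)) \<le> (\<Sum>v\<in>V - big. 3)"
  proof (rule sum_mono)
    fix v assume "v \<in> V - big"
    then show "card (nbrs v \<inter> big) \<le> 3" using deg_split[of v big] deg_not_big[of v] by auto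
  qed
  also have "\<dots> = 3 * (card V - card big)"
    using card_Diff_subset[OF finite_big big_subset] by simp
  finally show ?thesis
    using degsum_within_big[OF order_refl assms] card_mono[OF finite_V big_subset] by linarith
qed

section \<open>Vertices of very large degree\<close>

text \<open>If \<open>a\<close> has very large degree, this makes the side opposite to
  \<open>a\<close> tiny.\<close>

lemma sep_side_subset_non_nbrs:
  assumes "sep a b A B T"
  shows "B - {b} \<subseteq> V - insert a (nbrs a)"
  using assms unfolding sep_def by auto

lemma card_non_nbrs:
  assumes "a \<in> V"
  shows "card (V - insert a (nbrs a)) + Suc (deg a) = card V"
proof -
  have "card (insert a (nbrs a)) = Suc (deg a)"
    unfolding deg_def using E_irrefl finite_nbrs by (simp add: card_insert_if)
  moreover have "insert a (nbrs a) \<subseteq> V" using assms nbrs_subset by auto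
  ultimately show ?thesis
    using card_Diff_subset[of "insert a (nbrs a)" V] card_mono[of V "insert a (nbrs a)"] finite_V finite_nbrs
    by auto
qed

lemma card_le_sep:
  assumes "sep a b A B T"
  shows "card V \<le> card A + card B + card T"
proof -
  have "V = A \<union> B \<union> T" using assms unfolding sep_def by blast
  then show ?thesis by (metis card_Un_le add_le_mono1 order_trans)
qed

text \<open>Since \<open>a\<close> has no non-neighbours, the side of \<open>b\<close> in a
  separation of the edge \<open>a b\<close> is \<open>{b}\<close>, which is too small for a vertex
  of degree at least 4.\<close>

lemma deg_eq_3_if_hub:
  assumes a: "a \<in> V" "Suc (deg a) = card V" and b: "b \<in> V" "b \<noteq> a"
  shows "deg b = 3"
proof (rule ccontr)
  assume "deg b \<noteq> 3"
  then have d: "deg b \<ge> 4" using deg_ge_3[OF b(1)] by linarith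
  have none: "V - insert a (nbrs a) = {}"
    using card_non_nbrs[OF a(1)] a(2) finite_V by auto
  then have "(a, b) \<in> E" using b by auto
  then obtain A B T where s: "sep a b A B T" using sep_exists by blast
  have "card B \<ge> 2" using sep_side_not_singleton(1)[OF sep_sym[OF s] d] .
  moreover have "B \<subseteq> {b}" using sep_side_subset_non_nbrs[OF s] none by blast
  then have "card B \<le> card {b}" by (intro card_mono) auto
  ultimately show False by simp
qed

text \<open>Let \<open>c\<close> be the one non-neighbour of \<open>a\<close>. For a big neighbour
  \<open>b\<close> of \<open>a\<close>, the separation of the edge \<open>a b\<close> has side
  \<open>{b, c}\<close>, and tightness determines the neighbourhoods of \<open>b\<close> and
  \<open>c\<close>.\<close>

lemma big_if_deg_minus_2:
  assumes a: "a \<in> V" "deg a + 2 = card V"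
  shows "card (big - {a}) \<le> 1" and "b \<in> big \<Longrightarrow> b \<noteq> a \<Longrightarrow> deg b = 4"
proof -
  have "card (V - insert a (nbrs a)) = 1" using card_non_nbrs[OF a(1)] a(2) by linarith
  then obtain c where c: "V - insert a (nbrs a) = {c}" by (auto simp: card_Suc_eq)
  have "c \<in> V - insert a (nbrs a)" unfolding c by simp
  then have cV: "c \<in> V" "c \<noteq> a" "(a, c) \<notin> E" by auto
  have adj: "(a, v) \<in> E" if "v \<in> V" "v \<noteq> a" "v \<noteq> c" for v
  proof (rule ccontr)
    assume "(a, v) \<notin> E"
    then have "v \<in> V - insert a (nbrs a)" using that by simp
    then show False using that(3) unfolding c by simp
  qed
  have a_big: "a \<in> big" using a card_V unfolding big_def by auto
  have key: "\<exists>T. nbrs b = insert a (insert c T) \<and> nbrs c = insert b T \<and> deg b = 4 \<and> T \<inter> big = {}"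
    if b: "b \<in> big" "(a, b) \<in> E" for b
  proof -
    obtain A B T where s: "sep a b A B T" using sep_exists b by blast
    note s' = sep_sym[OF s]
    have fin: "finite B" "finite T" "card T \<le> 2" "b \<in> B" "a \<in> A" "A \<inter> B = {}" "A \<inter> T = {}" "B \<inter> T = {}" "T \<subseteq> V"
      using s finite_sub unfolding sep_def by auto
    have d: "deg b \<ge> 4" using b unfolding big_def by auto
    have B: "B \<subseteq> {b, c}" using sep_side_subset_non_nbrs[OF s] unfolding c by blast
    have "card B \<ge> 2" using sep_side_not_singleton(1)[OF s' d] .
    moreover have "card {b, c} \<le> 2" by (simp add: card_insert_if)
    ultimately have Beq: "B = {b, c}" and cB: "card B = 2"
      using card_seteq[OF _ B] card_mono[OF _ B] by auto
    have bc: "b \<noteq> c" using cB Beq by auto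
    have T: "T \<subseteq> nbrs b" "card T = 2" using sep_side_not_singleton(2)[OF s' d cB] by auto
    have nb: "nbrs b \<subseteq> insert a (insert c T)" using sep_nbrs(1)[OF s'] Beq by blast
    have nc: "nbrs c \<subseteq> insert b T" using sep_nbrs(2)[OF s', of c] Beq bc by blast
    have c4: "card (insert a (insert c T)) \<le> 4" "finite (insert a (insert c T))"
      using T fin by (auto simp: card_insert_if)
    have c3: "card (insert b T) \<le> 3" "finite (insert b T)"
      using T fin by (auto simp: card_insert_if)
    have "deg b = 4" using deg_le_cover[OF nb c4(2)] c4(1) d by linarith
    moreover have "nbrs b = insert a (insert c T)"
      using card_seteq[OF c4(2) nb] c4(1) d unfolding deg_def by linarith
    moreover have "nbrs c = insert b T"
      using card_seteq[OF c3(2) nc] c3(1) deg_ge_3[OF cV(1)] unfolding deg_def by linarith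
    \<comment> \<open>A big \<open>t\<close> would form a big triangle with \<open>a\<close> and
      \<open>b\<close>.\<close>
    moreover have "t \<notin> big" if t: "t \<in> T" for t
    proof
      assume "t \<in> big"
      moreover have "(b, t) \<in> E" using T t by auto
      moreover have "t \<in> V" "t \<noteq> a" "t \<noteq> c" using t fin Beq by auto
      then have "(a, t) \<in> E" using adj by blast
      ultimately show False using no_big_triangle[OF a_big b(1)] b(2) by blast
    qed
    ultimately show ?thesis by blast
  qed
  \<comment> \<open>If \<open>c\<close> were big, all other vertices but \<open>a\<close> would have degree 3, and the graph without \<open>a\<close> and \<open>c\<close>
    would have too few edges to be connected.\<close>
  have c_big: "c \<notin> big"
  proof
    assume cb: "c \<in> big"
    \<comment> \<open>A further big vertex \<open>v\<close> would have degree
      \<open>card T + 2\<close>, equal to 4, which leaves \<open>c\<close> with degree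
      \<open>card T + 1\<close>, only 3.\<close>
    have big_eq: "big = {a, c}"
    proof -
      have False if v: "v \<in> big" "v \<noteq> a" "v \<noteq> c" for v
      proof -
        have "(a, v) \<in> E" using adj v big_subset by blast
        from key[OF v(1) this] obtain T where T: "nbrs c = insert v T" "nbrs v = insert a (insert c T)" "deg v = 4"
          by blast
        have finT: "finite T" using T(1) finite_nbrs[of c] by simp
        have "c \<notin> T" using T(1) E_irrefl[of c] in_nbrs[of c c] by blast
        have "v \<notin> T" using T(2) E_irrefl[of v] in_nbrs[of v v] by blast
        then have "deg c = Suc (card T)" using T(1) finT unfolding deg_def by simp
        moreover have "a \<notin> T" using T(1) cV(3) E_sym[of c a] in_nbrs[of a c] by blast
        then have "deg v = Suc (Suc (card T))"
          using T(2) finT \<open>c \<notin> T\<close> cV(2) unfolding deg_def by simp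
        ultimately show False using T(3) cb unfolding big_def by simp
      qed
      then show ?thesis using cb a_big by blast
    qed
    define W where "W = V - {a, c}"
    have finW: "finite W" using finite_V unfolding W_def by simp
    have VW: "V - W = {a, c}" using a cV unfolding W_def by auto
    have cW: "card W + 2 = card V"
      using a cV card_V finite_V unfolding W_def by (subst card_Diff_subset) auto
    have "degsum_within W + 2 \<ge> 2 * card W"
      using cV VW unfolding W_def by (intro degsum_within_connected) auto
    \<comment> \<open>Each vertex of \<open>W\<close> spends one of its three edges on
      \<open>a\<close>, so \<open>degsum_within W + deg c\<close> equals \<open>2 * card W\<close>,
      and connectedness leaves \<open>deg c\<close> at most 2.\<close>
    moreover have "(\<Sum>v\<in>W. card (nbrs v \<inter> W) + 1 + card (nbrs v \<inter> {c})) = (\<Sum>v\<in>W. 3)"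
    proof (rule sum.cong[OF refl])
      fix v assume v: "v \<in> W"
      then have "deg v = 3" using big_eq deg_not_big unfolding W_def by blast
      moreover have "nbrs v = (nbrs v \<inter> W) \<union> ({a} \<union> (nbrs v \<inter> {c}))"
        using nbrs_subset[of v] v adj[of v] E_sym unfolding W_def by auto
      then have "deg v = card ((nbrs v \<inter> W) \<union> ({a} \<union> (nbrs v \<inter> {c})))"
        unfolding deg_def by simp
      moreover have "card ((nbrs v \<inter> W) \<union> ({a} \<union> (nbrs v \<inter> {c})))
          = card (nbrs v \<inter> W) + (1 + card (nbrs v \<inter> {c}))"
        using finW cV by (subst card_Un_disjoint, auto simp: W_def)+
      ultimately show "card (nbrs v \<inter> W) + 1 + card (nbrs v \<inter> {c}) = 3" by simp
    qed
    then have "degsum_within W + card W + (\<Sum>v\<in>W. card (nbrs v \<inter> {c})) = 3 * card W"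
      unfolding degsum_within_def by (simp only: sum.distrib sum_constant) simp
    moreover have "(\<Sum>v\<in>W. card (nbrs v \<inter> {c})) = card (nbrs c \<inter> W)"
      using sum_card_nbrs_swap[OF finW, of "{c}"] by simp
    moreover have "nbrs c \<inter> W = nbrs c"
      using nbrs_subset[of c] cV E_sym E_irrefl unfolding W_def by auto
    ultimately have "deg c \<le> 2" unfolding deg_def by simp
    then show False using cb unfolding big_def by auto
  qed
  have adj_big: "(a, v) \<in> E" if "v \<in> big" "v \<noteq> a" for v
    using adj that c_big big_subset by blast
  show "deg b = 4" if "b \<in> big" "b \<noteq> a" for b
    using key[OF that(1) adj_big[OF that]] by blast
  \<comment> \<open>Both are neighbours of \<open>c\<close>, and \<open>u\<close> is the only big
    one.\<close>
  have "u = v" if u: "u \<in> big" "u \<noteq> a" and v: "v \<in> big" "v \<noteq> a" for u v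
  proof -
    obtain T where T: "nbrs c = insert u T" "T \<inter> big = {}"
      using key[OF u(1) adj_big[OF u]] by blast
    obtain T' where "nbrs c = insert v T'"
      using key[OF v(1) adj_big[OF v]] by blast
    then have "v \<in> insert u T" unfolding T(1) by blast
    then show ?thesis using T(2) v(1) by blast
  qed
  then show "card (big - {a}) \<le> 1"
    using card_le_Suc0_iff_eq[of "big - {a}"] finite_big by auto
qed

text \<open>The main point is independence of \<open>big\<close>. An edge \<open>a b\<close> inside
  it has a separation with sides of at most three vertices, since \<open>a\<close> and
  \<open>b\<close> have two non-neighbours each; the third big vertex then fits nowhere.\<close>

lemma bipartite_if_three_big:
  assumes c3: "card big = 3" and d: "\<And>v. v \<in> big \<Longrightarrow> deg v + 3 = card V"
  shows "E = big \<times> (V - big) \<union> (V - big) \<times> big"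
proof -
  have indep: "(a, b) \<notin> E" if ab: "a \<in> big" "b \<in> big" for a b
  proof
    assume e: "(a, b) \<in> E"
    then have "a \<noteq> b" using E_irrefl by auto
    then have "card (big - {a, b}) = 1" using c3 ab finite_big by (subst card_Diff_subset) auto
    then obtain c where c: "c \<in> big" "c \<noteq> a" "c \<noteq> b" by (auto simp: card_Suc_eq)
    obtain A B T where s: "sep a b A B T" using sep_exists e by blast
    \<comment> \<open>Stated for an arbitrary separation so that it also applies to the side
      \<open>A\<close> after \<open>sep_sym\<close>. When \<open>B\<close> has three elements it
      uses up all non-neighbours of \<open>a\<close>, so \<open>T\<close> consists of
      neighbours.\<close>
    have side: "card B \<le> 3 \<and> (card B = 3 \<longrightarrow> T \<subseteq> nbrs a) \<and> (c \<in> B \<longrightarrow> deg c \<le> 4)"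
      if s: "sep a b A B T" and ab: "a \<in> big" "b \<in> big" "c \<noteq> b" for a b A B T
    proof -
      have V: "B \<subseteq> V" "T \<subseteq> V" "A \<inter> T = {}" "B \<inter> T = {}" "b \<in> B" "a \<in> A" "card T \<le> 2"
        using s unfolding sep_def by auto
      have finB: "finite B" "finite T" using V finite_sub by auto
      have cN: "card (V - insert a (nbrs a)) = 2"
        using card_non_nbrs[of a] d[OF ab(1)] ab big_subset by auto
      note sub = sep_side_subset_non_nbrs[OF s]
      have "card (B - {b}) \<le> 2" using card_mono[OF _ sub] cN finite_V by auto
      then have cB: "card B \<le> 3" using V finB by auto
      moreover have "T \<subseteq> nbrs a" if "card B = 3"
      proof -
        have "card (B - {b}) = 2" using that V finB by auto
        then have "B - {b} = V - insert a (nbrs a)"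
          using card_seteq[OF _ sub] cN finite_V by auto
        then show ?thesis using V by blast
      qed
      moreover have "deg c \<le> 4" if "c \<in> B"
      proof -
        have "nbrs c \<subseteq> (B - {c}) \<union> T" using sep_nbrs(2)[OF sep_sym[OF s] that ab(3)] .
        then have "deg c \<le> card ((B - {c}) \<union> T)" using finB by (intro deg_le_cover) auto
        also have "\<dots> \<le> card (B - {c}) + card T" by (rule card_Un_le)
        also have "\<dots> \<le> 4" using cB that finB V by auto
        finally show ?thesis .
      qed
      ultimately show ?thesis by blast
    qed
    note sA = side[OF sep_sym[OF s] ab(2,1) c(2)] and sB = side[OF s ab c(3)]
    have "card T \<le> 2" "V = A \<union> B \<union> T" using s unfolding sep_def by auto
    \<comment> \<open>At least eight vertices must fit into 3 + 3 + 2.\<close>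
    then have cc: "card A = 3" "card B = 3" "card T = 2"
      using card_le_sep[OF s] card_V sA sB by linarith+
    have "c \<in> A \<or> c \<in> B \<or> c \<in> T" using c(1) big_subset \<open>V = A \<union> B \<union> T\<close> by blast
    moreover have "deg c \<ge> 5" using d[OF c(1)] card_V by linarith
    \<comment> \<open>Its degree of at least 5 excludes \<open>c\<close> from both sides; in
      \<open>T\<close> it is adjacent to both \<open>a\<close> and \<open>b\<close>, a big
      triangle.\<close>
    ultimately have "c \<in> T" using sA sB cc by auto
    then have "(a, c) \<in> E" "(b, c) \<in> E" using sA sB cc by auto
    then show False using no_big_triangle[OF ab c(1) e] by blast
  qed
  have cV: "card (V - big) + 3 = card V"
    using c3 card_Diff_subset[OF finite_big big_subset] card_V by linarith
  have nb: "nbrs v = V - big" if v: "v \<in> big" for v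
  proof (rule card_seteq)
    show "nbrs v \<subseteq> V - big" using indep[OF v] nbrs_subset by auto
    show "card (V - big) \<le> card (nbrs v)" using cV d[OF v] unfolding deg_def by linarith
  qed (use finite_V in simp)
  have ns: "nbrs v = big" if v: "v \<in> V - big" for v
  proof (rule sym, rule card_seteq[OF finite_nbrs])
    show "big \<subseteq> nbrs v" using nb v E_sym by fastforce
    show "card (nbrs v) \<le> card big" using deg_not_big[of v] v c3 unfolding deg_def by auto
  qed
  have "(v, w) \<in> E \<longleftrightarrow> (v, w) \<in> big \<times> (V - big) \<union> (V - big) \<times> big" for v w
  proof -
    consider "v \<in> big" | "v \<in> V - big" | "v \<notin> V" by blast
    then show ?thesis
    proof cases
      case 1
      then show ?thesis using nb[OF 1] in_nbrs[of w v] by simp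
    next
      case 2
      then show ?thesis using ns[OF 2] in_nbrs[of w v] by simp
    next
      case 3
      then show ?thesis using E_in_V[of v w] big_subset by blast
    qed
  qed
  then show ?thesis by (simp add: set_eq_iff)
qed

section \<open>Power sums of degrees\<close>

definition power_sum :: "nat \<Rightarrow> nat" where
  "power_sum p = (\<Sum>v\<in>V. deg v ^ p)"

text \<open>Measured against the baseline \<open>3 ^ p\<close> per vertex, only big vertices
  contribute; integers keep the differences exact.\<close>

lemma power_sum_excess:
  "int (power_sum p) = int (card V) * 3 ^ p + (\<Sum>v\<in>big. int (deg v) ^ p - 3 ^ p)"
proof -
  have "(\<Sum>v\<in>big. int (deg v) ^ p - 3 ^ p) = (\<Sum>v\<in>V. int (deg v) ^ p - 3 ^ p)"
    by (rule sum.mono_neutral_left[OF finite_V big_subset]) (auto simp: deg_not_big)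
  then show ?thesis unfolding power_sum_def by (simp add: sum_subtractf)
qed

text \<open>Compared with the wheel, at most one unit of degree sits on a vertex of degree 4 instead
  of on \<open>a\<close>; moving it to \<open>a\<close> increases the power sum by
  \<open>power_step_less\<close>.\<close>

lemma power_sum_less_wheel:
  assumes a: "a \<in> V" "deg a + 2 = card V" and p: "p > 1"
  shows "power_sum p < (card V - 1) ^ p + (card V - 1) * 3 ^ p"
proof -
  have a_big: "a \<in> big" using a card_V unfolding big_def by auto
  have "(\<Sum>v\<in>big. int (deg v) ^ p - 3 ^ p) =
      (int (deg a) ^ p - 3 ^ p) + (\<Sum>v\<in>big - {a}. int (deg v) ^ p - 3 ^ p)"
    by (rule sum.remove[OF finite_big a_big])
  also have "(\<Sum>v\<in>big - {a}. int (deg v) ^ p - 3 ^ p) = int (card (big - {a})) * (4 ^ p - 3 ^ p)"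
    using big_if_deg_minus_2(2)[OF a] by simp
  also have "\<dots> \<le> 1 * (4 ^ p - 3 ^ p)"
    using big_if_deg_minus_2(1)[OF a] by (intro mult_right_mono) (auto intro: power_mono)
  finally have "int (power_sum p) \<le> int (card V) * 3 ^ p + (int (deg a) ^ p - 3 ^ p) + (4 ^ p - 3 ^ p)"
    unfolding power_sum_excess by simp
  moreover have "(3 + 1) ^ p - 3 ^ p < (int (deg a) + 1) ^ p - int (deg a) ^ p"
    using a card_V p by (intro power_step_less) auto
  ultimately have "int (power_sum p) < (int (deg a) + 1) ^ p + (int (card V) - 1) * 3 ^ p"
    by (simp add: algebra_simps)
  also have "\<dots> = int ((card V - 1) ^ p + (card V - 1) * 3 ^ p)"
  proof -
    have "card V - 1 = deg a + 1" "int (card V) - 1 = int (deg a) + 1" using a(2) by linarith+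
    then show ?thesis by (simp add: algebra_simps)
  qed
  finally show ?thesis by linarith
qed

lemma power_sum_le_bipartite:
  assumes d: "\<And>v. v \<in> V \<Longrightarrow> deg v + 3 \<le> card V" and p: "p > 1"
  shows "power_sum p \<le> 3 * (card V - 3) ^ p + (card V - 3) * 3 ^ p"
    and "power_sum p = 3 * (card V - 3) ^ p + (card V - 3) * 3 ^ p \<Longrightarrow>
      card big = 3 \<and> (\<forall>v\<in>big. deg v + 3 = card V)"
proof -
  define m where "m = int (card V) - 3"
  define e where "e v = int (deg v) ^ p - 3 ^ p" for v
  have m: "m \<ge> 5" using card_V unfolding m_def by linarith
  \<comment> \<open>The bipartite value is the baseline plus three maximal excesses, so only the sum
    of \<open>e\<close> over \<open>big\<close> has to be bounded.\<close>
  have K: "int (3 * (card V - 3) ^ p + (card V - 3) * 3 ^ p) = int (card V) * 3 ^ p + 3 * (m ^ p - 3 ^ p)"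
  proof -
    have "int (card V - 3) = m" "int (card V) = m + 3" using card_V unfolding m_def by linarith+
    then have "int (3 * (card V - 3) ^ p + (card V - 3) * 3 ^ p) = 3 * m ^ p + m * 3 ^ p" by simp
    then show ?thesis unfolding \<open>int (card V) = m + 3\<close> by (simp only: algebra_simps)
  qed
  have dv: "3 < int (deg v)" "int (deg v) \<le> m" if "v \<in> big" for v
    using that d[of v] unfolding big_def m_def by auto
  have e_le: "e v \<le> m ^ p - 3 ^ p" if "v \<in> big" for v
    unfolding e_def using dv[OF that] by (simp add: power_mono)
  have e_less: "e v < m ^ p - 3 ^ p" if "v \<in> big" "int (deg v) < m" for v
    unfolding e_def using that(2) p by (simp add: power_strict_mono)
  have pos: "m ^ p - 3 ^ p > 0" using m p by (simp add: power_strict_mono)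
  have "(\<Sum>v\<in>big. e v) \<le> 3 * (m ^ p - 3 ^ p) \<and>
    ((\<Sum>v\<in>big. e v) = 3 * (m ^ p - 3 ^ p) \<longrightarrow> card big = 3 \<and> (\<forall>v\<in>big. int (deg v) = m))"
  proof (cases "card big \<le> 3")
    case True
    have le: "(\<Sum>v\<in>big. e v) \<le> int (card big) * (m ^ p - 3 ^ p)"
      using sum_bounded_above[of big e, OF e_le] by simp
    have le3: "int (card big) * (m ^ p - 3 ^ p) \<le> 3 * (m ^ p - 3 ^ p)"
      using True pos by (intro mult_right_mono) auto
    have "card big = 3 \<and> (\<forall>v\<in>big. int (deg v) = m)" if eq: "(\<Sum>v\<in>big. e v) = 3 * (m ^ p - 3 ^ p)"
    proof (intro conjI ballI)
      have "3 * (m ^ p - 3 ^ p) \<le> int (card big) * (m ^ p - 3 ^ p)" using le eq by simp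
      then have "3 \<le> int (card big)" using mult_le_cancel_right_pos[OF pos] by blast
      then show c3: "card big = 3" using True by linarith
      fix v assume v: "v \<in> big"
      show "int (deg v) = m"
      proof (rule ccontr)
        assume "int (deg v) \<noteq> m"
        then have "e v < m ^ p - 3 ^ p" using e_less[OF v] dv[OF v] by linarith
        then have "(\<Sum>v\<in>big. e v) < (\<Sum>v\<in>big. m ^ p - 3 ^ p)"
          using e_le v by (intro sum_strict_mono_ex1[OF finite_big]) auto
        then show False using eq c3 by simp
      qed
    qed
    then show ?thesis using le le3 by auto
  next
    case False
    \<comment> \<open>Each excess \<open>e v\<close> lies below the chord of \<open>x ^ p\<close> from 3 to \<open>m\<close>, and the forest
      property bounds the sum of \<open>deg v - 3\<close> by its value for the complete bipartite graph.\<close>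
    have ne: "big \<noteq> {}" using False by auto
    have "(\<Sum>v\<in>big. int (deg v)) + int (card big) + 2 \<le> 3 * int (card V)"
      using sum_deg_big[OF ne] by (metis (mono_tags) of_nat_add of_nat_le_iff of_nat_mult of_nat_numeral of_nat_sum)
    \<comment> \<open>\<open>sum_deg_big\<close> bounds the left side by
      \<open>3 * m + 7 - 4 * card big\<close>, which equals \<open>3 * (m - 3)\<close> exactly when
      \<open>card big\<close> is 4.\<close>
    then have total: "(\<Sum>v\<in>big. int (deg v) - 3) \<le> 3 * (m - 3)"
      using False unfolding m_def by (simp add: sum_subtractf)
    have chord: "(m - 3) * e v \<le> (int (deg v) - 3) * (m ^ p - 3 ^ p)" if "v \<in> big" for v
      using power_diff_chord_less[of 3 "int (deg v)" m p] dv[OF that] p unfolding e_def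
      by (cases "int (deg v) = m") auto
    \<comment> \<open>Four or more vertices of degree \<open>m\<close> would violate
      \<open>total\<close>; a vertex below \<open>m\<close> makes its chord inequality
      strict.\<close>
    have "\<exists>v\<in>big. int (deg v) < m"
    proof (rule ccontr)
      assume "\<not> ?thesis"
      then have "int (deg v) = m" if "v \<in> big" for v using dv[OF that] that by fastforce
      then have "int (card big) * (m - 3) \<le> 3 * (m - 3)" using total by simp
      then have "int (card big) \<le> 3" using m mult_le_cancel_right_pos[of "m - 3" "int (card big)" 3] by linarith
      then show False using False by linarith
    qed
    then obtain u where u: "u \<in> big" "int (deg u) < m" by blast
    have "(m - 3) * e u < (int (deg u) - 3) * (m ^ p - 3 ^ p)"
      using power_diff_chord_less[of 3 "int (deg u)" m p] dv[OF u(1)] u p unfolding e_def by auto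
    then have "(\<Sum>v\<in>big. (m - 3) * e v) < (\<Sum>v\<in>big. (int (deg v) - 3) * (m ^ p - 3 ^ p))"
      using chord u by (intro sum_strict_mono_ex1[OF finite_big]) auto
    also have "\<dots> \<le> (3 * (m - 3)) * (m ^ p - 3 ^ p)"
      unfolding sum_distrib_right[symmetric] using total pos by (intro mult_right_mono) auto
    also have "\<dots> = (m - 3) * (3 * (m ^ p - 3 ^ p))" by (simp only: ac_simps)
    finally have "(m - 3) * (\<Sum>v\<in>big. e v) < (m - 3) * (3 * (m ^ p - 3 ^ p))"
      unfolding sum_distrib_left .
    then have "(\<Sum>v\<in>big. e v) < 3 * (m ^ p - 3 ^ p)"
      using m by (subst (asm) mult_less_cancel_left_pos) auto
    then show ?thesis by linarith
  qed
  then have le: "(\<Sum>v\<in>big. e v) \<le> 3 * (m ^ p - 3 ^ p)"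
    and eq: "(\<Sum>v\<in>big. e v) = 3 * (m ^ p - 3 ^ p) \<Longrightarrow> card big = 3 \<and> (\<forall>v\<in>big. int (deg v) = m)"
    by blast+
  have P: "int (power_sum p) = int (card V) * 3 ^ p + (\<Sum>v\<in>big. e v)"
    unfolding power_sum_excess e_def ..
  have "int (power_sum p) \<le> int (3 * (card V - 3) ^ p + (card V - 3) * 3 ^ p)"
    unfolding P K using le by simp
  then show "power_sum p \<le> 3 * (card V - 3) ^ p + (card V - 3) * 3 ^ p"
    by (simp only: of_nat_le_iff)
  assume "power_sum p = 3 * (card V - 3) ^ p + (card V - 3) * 3 ^ p"
  then have "(\<Sum>v\<in>big. e v) = 3 * (m ^ p - 3 ^ p)" using P K by linarith
  then show "card big = 3 \<and> (\<forall>v\<in>big. deg v + 3 = card V)"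
    using eq unfolding m_def by force
qed

end

section \<open>Isomorphisms and connectivity of pair graphs\<close>

text \<open>A walk that never turns back first repeats a vertex at its starting point. The closed
  walk contains both neighbours of each of its vertices, so by \<open>conn\<close> it covers
  \<open>W\<close>.\<close>

lemma two_regular_connected_cycle:
  fixes W :: "'a set" and R :: "('a \<times> 'a) set"
  assumes fin: "finite W" and ne: "W \<noteq> {}" and RW: "R \<subseteq> W \<times> W"
    and sym: "\<And>x y. (x, y) \<in> R \<Longrightarrow> (y, x) \<in> R" and irrefl: "\<And>x. (x, x) \<notin> R"
    and two: "\<And>w. w \<in> W \<Longrightarrow> card {u. (w, u) \<in> R} = 2"
    and conn: "\<And>X. X \<subseteq> W \<Longrightarrow> X \<noteq> {} \<Longrightarrow> (\<And>x y. x \<in> X \<Longrightarrow> (x, y) \<in> R \<Longrightarrow> y \<in> X) \<Longrightarrow> X = W"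
  shows "\<exists>f. bij_betw f {..<card W} W \<and>
    (\<forall>i<card W. \<forall>j<card W. (f i, f j) \<in> R \<longleftrightarrow> j = Suc i mod card W \<or> i = Suc j mod card W)"
proof -
  have finR: "finite {u. (w, u) \<in> R}" for w
    using fin RW by (rule_tac finite_subset[of _ W]) auto
  have other: "\<exists>x. (w, x) \<in> R \<and> x \<noteq> u" if "w \<in> W" for u w
  proof (rule ccontr)
    assume "\<not> ?thesis"
    then have "card {u. (w, u) \<in> R} \<le> card {u}" by (intro card_mono) auto
    then show False using two[OF that] by simp
  qed
  obtain w0 where w0: "w0 \<in> W" using ne by blast
  obtain w1 where w1: "(w0, w1) \<in> R" using other[OF w0] by blast
  \<comment> \<open>The walk is chosen as a sequence of arcs, so that each choice knows the vertex
    it must not return to.\<close>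
  have "\<exists>g. \<forall>n. g n \<in> R \<and> (fst (g (Suc n)) = snd (g n) \<and> snd (g (Suc n)) \<noteq> fst (g n))"
  proof (rule dependent_nat_choice)
    show "\<exists>e. e \<in> R" using w1 by blast
    fix e assume "e \<in> R"
    then have "snd e \<in> W" using RW by auto
    then obtain x where "(snd e, x) \<in> R" "x \<noteq> fst e" using other by blast
    then show "\<exists>e'. e' \<in> R \<and> fst e' = snd e \<and> snd e' \<noteq> fst e"
      by (intro exI[of _ "(snd e, x)"]) auto
  qed
  then obtain g where g: "\<And>n. g n \<in> R" "\<And>n. fst (g (Suc n)) = snd (g n)" "\<And>n. snd (g (Suc n)) \<noteq> fst (g n)"
    by blast
  define v where "v n = fst (g n)" for n
  have R1: "(v n, v (Suc n)) \<in> R" for n using g(1)[of n] g(2)[of n] unfolding v_def by (metis prod.collapse)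
  have R2: "v (Suc (Suc n)) \<noteq> v n" for n using g(2)[of "Suc n"] g(3)[of n] unfolding v_def by simp
  have vW: "v n \<in> W" for n using R1[of n] RW by auto
  have nb2: "{u. (w, u) \<in> R} = {x, y}" if "(w, x) \<in> R" "(w, y) \<in> R" "x \<noteq> y" for w x y
  proof (rule HOL.sym, rule card_seteq[OF finR])
    show "{x, y} \<subseteq> {u. (w, u) \<in> R}" using that by auto
    have "w \<in> W" using that RW by auto
    then show "card {u. (w, u) \<in> R} \<le> card {x, y}" using two[of w] that by simp
  qed
  have N: "{u. (v (Suc k), u) \<in> R} = {v k, v (Suc (Suc k))}" for k
    using nb2[OF sym[OF R1[of k]] R1[of "Suc k"]] R2[of k] by metis
  have "\<exists>j. \<exists>i<j. v j = v i"
  proof (rule ccontr)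
    assume "\<not> ?thesis"
    then have "inj v" by (intro linorder_injI) metis
    then have "infinite (range v)" using finite_imageD by blast
    moreover have "range v \<subseteq> W" using vW by auto
    ultimately show False using fin finite_subset by blast
  qed
  define m where "m = (LEAST j. \<exists>i<j. v j = v i)"
  have "\<exists>i<m. v m = v i" unfolding m_def by (rule LeastI_ex) fact
  then obtain i where i: "i < m" "v m = v i" by blast
  have min: "v j \<noteq> v k" if "k < j" "j < m" for j k
    using not_less_Least[of j "\<lambda>j. \<exists>i<j. v j = v i"] that unfolding m_def by blast
  have inj: "inj_on v {..<m}"
    by (rule linorder_inj_onI) (use min in \<open>auto simp: eq_commute\<close>)
  \<comment> \<open>For \<open>i > 0\<close>, the vertex before \<open>v m\<close> is a neighbour of
    \<open>v i\<close>, hence equals the predecessor or successor of \<open>v i\<close> on the walk;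
    each option gives an earlier repetition, a loop or a turn back.\<close>
  have i0: "i = 0"
  proof (rule ccontr)
    assume "i \<noteq> 0"
    then obtain k where k: "i = Suc k" by (cases i) auto
    obtain l where l: "m = Suc l" using i(1) by (cases m) auto
    have "(v i, v l) \<in> R" using sym[OF R1[of l]] i(2) l by simp
    then have "v l \<in> {v k, v (Suc (Suc k))}" using N[of k] k by blast
    moreover have "v l \<noteq> v k" using min[of k l] i(1) k l by simp
    ultimately have eq: "v l = v (Suc (Suc k))" by blast
    have "l \<ge> Suc k" using i(1) k l by simp
    then consider "l = Suc k" | "l = Suc (Suc k)" | "l > Suc (Suc k)" by linarith
    then show False
    proof cases
      case 1
      then show False using eq R1[of l] irrefl by simp
    next
      case 2
      then show False using i(2) k l R2[of "Suc k"] by simp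
    next
      case 3
      then show False using min[of "Suc (Suc k)" l] l eq by simp
    qed
  qed
  have vm: "v m = v 0" using i i0 by simp
  have m3: "m \<ge> 3"
  proof -
    have "m \<noteq> 0" using i by auto
    moreover have "m \<noteq> 1" using R1[of 0] vm irrefl by auto
    moreover have "m \<noteq> 2" using R2[of 0] vm by (auto simp: numeral_2_eq_2)
    ultimately show ?thesis by linarith
  qed
  \<comment> \<open>The cyclic predecessor.\<close>
  define q where "q j = (if j = 0 then m - 1 else j - 1)" for j
  have vs: "v (Suc j mod m) = v (Suc j)" if "j < m" for j
    using that vm by (cases "Suc j = m") auto
  have q: "q j < m" "Suc (q j) mod m = j" if "j < m" for j
    using that m3 unfolding q_def by auto
  have qn: "{u. (v j, u) \<in> R} = {v (q j), v (Suc j mod m)}" if "j < m" for j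
  proof (cases j)
    case 0
    have "(v 0, v (m - 1)) \<in> R" using sym[OF R1[of "m - 1"]] vm m3 by simp
    moreover have "v (m - 1) \<noteq> v 1" using min[of 1 "m - 1"] m3 by simp
    ultimately show ?thesis using nb2[OF _ R1[of 0], of "v (m - 1)"] 0 m3 unfolding q_def by simp
  next
    case (Suc k)
    then show ?thesis using N[of k] vs[OF that] unfolding q_def by simp
  qed
  have XW: "v ` {..<m} = W"
  proof (rule conn)
    show "v ` {..<m} \<subseteq> W" using vW by auto
    show "v ` {..<m} \<noteq> {}" using i(1) by blast
    fix x y assume "x \<in> v ` {..<m}" "(x, y) \<in> R"
    then obtain j where j: "j < m" "(v j, y) \<in> R" by auto
    then have "y = v (q j) \<or> y = v (Suc j mod m)" using qn by blast
    then show "y \<in> v ` {..<m}" using q(1)[OF j(1)] m3 by auto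
  qed
  have cW: "card W = m" using card_image[OF inj] XW by simp
  have "(v a, v b) \<in> R \<longleftrightarrow> b = Suc a mod m \<or> a = Suc b mod m" if ab: "a < m" "b < m" for a b
  proof -
    have "(v a, v b) \<in> R \<longleftrightarrow> v b = v (q a) \<or> v b = v (Suc a mod m)"
      using qn[OF ab(1)] by blast
    also have "\<dots> \<longleftrightarrow> b = q a \<or> b = Suc a mod m"
      using inj_on_eq_iff[OF inj] ab q(1) m3 by simp
    also have "b = q a \<longleftrightarrow> a = Suc b mod m"
    proof
      show "b = q a \<Longrightarrow> a = Suc b mod m" using q(2)[OF ab(1)] by simp
      show "a = Suc b mod m \<Longrightarrow> b = q a"
        using ab unfolding q_def by (cases "Suc b = m") auto
    qed
    finally show ?thesis by blast
  qed
  then show ?thesis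
    using inj XW unfolding cW by (intro exI[of _ v]) (auto simp: bij_betw_def)
qed

section \<open>Isomorphisms of pair graphs and invariance of the power sum\<close>

lemma digraph_iso_with_projI:
  assumes G: "pair_wf_digraph G" and H: "pair_wf_digraph H"
    and f: "bij_betw f (pverts G) (pverts H)"
    and arcs: "\<And>u v. u \<in> pverts G \<Longrightarrow> v \<in> pverts G \<Longrightarrow> (f u, f v) \<in> parcs H \<longleftrightarrow> (u, v) \<in> parcs G"
  shows "digraph_iso (with_proj G) (with_proj H)"
proof -
  interpret G: pair_wf_digraph G by (rule G)
  interpret H: pair_wf_digraph H by (rule H)
  define h where "h = \<lparr>iso_verts = f, iso_arcs = map_prod f f, iso_head = snd, iso_tail = fst\<rparr>"
  have inj: "inj_on f (pverts G)" and im: "f ` pverts G = pverts H"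
    using f by (auto simp: bij_betw_def)
  have sub: "parcs G \<subseteq> pverts G \<times> pverts G" using G.in_arcsD1 G.in_arcsD2 by auto
  have "inj_on (map_prod f f) (parcs G)"
    using map_prod_inj_on[OF inj inj] sub inj_on_subset by blast
  then have "pre_digraph.digraph_isomorphism (with_proj G) h"
    unfolding pre_digraph.digraph_isomorphism_def h_def using inj G
    by (simp add: wf_digraph_wp_iff)
  moreover have "map_prod f f ` parcs G = parcs H"
  proof (intro equalityI subsetI)
    fix e assume "e \<in> map_prod f f ` parcs G"
    then obtain u v where "e = (f u, f v)" "(u, v) \<in> parcs G" by auto
    then show "e \<in> parcs H" using arcs sub by auto
  next
    fix e assume e: "e \<in> parcs H"
    then have "fst e \<in> f ` pverts G" "snd e \<in> f ` pverts G"
      using H.arc_fst_in_verts H.arc_snd_in_verts im by auto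
    then obtain u v where uv: "u \<in> pverts G" "v \<in> pverts G" "e = (f u, f v)"
      by (metis imageE prod.collapse)
    then have "(u, v) \<in> parcs G" using e arcs by simp
    then show "e \<in> map_prod f f ` parcs G" using uv by force
  qed
  then have "with_proj H = app_iso h (with_proj G)"
    unfolding app_iso_def h_def with_proj_def using im by simp
  ultimately show ?thesis unfolding digraph_iso_def by blast
qed

lemma degree_power_sum_iso:
  assumes "pair_wf_digraph G" "digraph_iso (with_proj G) (with_proj H)"
  shows "degree_power_sum p G = degree_power_sum p H"
proof -
  have wf: "wf_digraph (with_proj G)" using assms(1) by (simp add: wf_digraph_wp_iff)
  obtain h where h: "pre_digraph.digraph_isomorphism (with_proj G) h" and H: "with_proj H = app_iso h (with_proj G)"
    using assms(2) unfolding digraph_iso_def by blast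
  have inj: "inj_on (iso_verts h) (pverts G)"
    using pre_digraph.digraph_isomorphism_inj_on_verts[OF h] by simp
  have "pverts H = verts (with_proj H)" by simp
  also have "\<dots> = iso_verts h ` pverts G" unfolding H by simp
  finally have "degree_power_sum p H = (\<Sum>v\<in>iso_verts h ` pverts G. out_degree (app_iso h (with_proj G)) v ^ p)"
    unfolding degree_power_sum_def H by simp
  also have "\<dots> = (\<Sum>v\<in>pverts G. out_degree (with_proj G) v ^ p)"
    using wf_digraph.out_degree_app_iso_eq[OF wf h] by (simp add: sum.reindex[OF inj])
  finally show ?thesis unfolding degree_power_sum_def by simp
qed

text \<open>Translates reachability into cuts: a path leaving \<open>A\<close> uses an arc out of
  \<open>A\<close>, and conversely the set reachable from a vertex has no outgoing arc.\<close>

lemma connected_induce_iff: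
  assumes "sym (parcs G)"
  shows "connected (with_proj G \<restriction> W) \<longleftrightarrow>
    W \<noteq> {} \<and> (\<forall>A\<subseteq>W. A \<noteq> {} \<longrightarrow> A \<noteq> W \<longrightarrow> (\<exists>a\<in>A. \<exists>b\<in>W - A. (a, b) \<in> parcs G))"
proof -
  define R where "R = {(x, y) \<in> parcs G. x \<in> W \<and> y \<in> W}"
  have "arcs_ends (with_proj G \<restriction> W) = R"
    unfolding arcs_ends_conv R_def by force
  moreover have "symcl R = R" using assms[THEN symD] unfolding symcl_def R_def by auto
  ultimately have conv: "connected (with_proj G \<restriction> W) \<longleftrightarrow> W \<noteq> {} \<and> (\<forall>u\<in>W. \<forall>v\<in>W. (u, v) \<in> rtrancl_on W R)"
    by (simp add: connected_conv)
  show ?thesis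
  proof (intro iffI conjI allI impI)
    assume "connected (with_proj G \<restriction> W)"
    then have c: "W \<noteq> {}" "\<And>u v. u \<in> W \<Longrightarrow> v \<in> W \<Longrightarrow> (u, v) \<in> rtrancl_on W R"
      using conv by blast+
    show "W \<noteq> {}" by (rule c)
    fix A assume A: "A \<subseteq> W" "A \<noteq> {}" "A \<noteq> W"
    obtain u v where uv: "u \<in> A" "v \<in> W" "v \<notin> A" using A by blast
    show "\<exists>a\<in>A. \<exists>b\<in>W - A. (a, b) \<in> parcs G"
    proof (rule ccontr)
      assume no: "\<not> ?thesis"
      have "(u, v) \<in> rtrancl_on W R" using c(2) uv A by blast
      then have "v \<in> A"
        by (induction rule: rtrancl_on_induct) (use uv no in \<open>auto simp: R_def\<close>)
      then show False using uv by blast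
    qed
  next
    assume c: "W \<noteq> {} \<and> (\<forall>A\<subseteq>W. A \<noteq> {} \<longrightarrow> A \<noteq> W \<longrightarrow> (\<exists>a\<in>A. \<exists>b\<in>W - A. (a, b) \<in> parcs G))"
    have "(u, v) \<in> rtrancl_on W R" if uv: "u \<in> W" "v \<in> W" for u v
    proof -
      define A where "A = {x \<in> W. (u, x) \<in> rtrancl_on W R}"
      have "u \<in> A" using uv unfolding A_def by auto
      moreover have "\<not> (\<exists>a\<in>A. \<exists>b\<in>W - A. (a, b) \<in> parcs G)"
        unfolding A_def R_def by (auto intro: rtrancl_on_into_rtrancl_on)
      moreover have "A \<subseteq> W" unfolding A_def by auto
      ultimately have "A = W" using c by blast
      then show ?thesis using uv unfolding A_def by blast
    qed
    then show "connected (with_proj G \<restriction> W)" using c conv by blast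
  qed
qed

lemma (in pair_graph) min_3_connected_graph:
  assumes m: "minimally_three_connected G" and n: "card (pverts G) \<ge> 8"
  shows "min_3_connected_graph (pverts G) (parcs G)"
proof
  have sym: "(y, x) \<in> parcs G" if "(x, y) \<in> parcs G" for x y
    using that arcs_symmetric by blast
  have conn: "\<exists>a\<in>A. \<exists>b\<in>W - A. (a, b) \<in> parcs G"
    if "S \<subseteq> pverts G" "card S \<le> 2" "W = pverts G - S" "A \<subseteq> W" "A \<noteq> {}" "A \<noteq> W" for A S W
  proof -
    have "finite S" using that(1) pair_finite_verts finite_subset by blast
    then have "connected (with_proj G \<restriction> W)"
      using m that(1-3) unfolding minimally_three_connected_def three_connected_def by auto
    then show ?thesis using that(4-6) connected_induce_iff[of G W] sym unfolding sym_def by blast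
  qed
  show "finite (pverts G)" by (rule pair_finite_verts)
  show "parcs G \<subseteq> pverts G \<times> pverts G" using in_arcsD1 in_arcsD2 by auto
  show "(y, x) \<in> parcs G" if "(x, y) \<in> parcs G" for x y using that by (rule sym)
  show "(x, x) \<notin> parcs G" for x using no_loops'[of x x] by blast
  show "8 \<le> card (pverts G)" by (rule n)
  show "\<exists>a\<in>A. \<exists>b\<in>B. (a, b) \<in> parcs G"
    if V: "pverts G = A \<union> B \<union> T" and d: "A \<inter> B = {}" "A \<noteq> {}" "B \<noteq> {}" "A \<inter> T = {}" "B \<inter> T = {}" "card T \<le> 2" for A B T
  proof -
    have W: "A \<union> B = pverts G - T" unfolding V using d by blast
    have "T \<subseteq> pverts G" unfolding V by blast
    from conn[OF this d(6) W, of A] have "\<exists>a\<in>A. \<exists>b\<in>A \<union> B - A. (a, b) \<in> parcs G"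
      using d by blast
    then show ?thesis by blast
  qed
  show "\<exists>A B T. pverts G = A \<union> B \<union> T \<and> A \<inter> B = {} \<and> A \<inter> T = {} \<and> B \<inter> T = {} \<and> card T \<le> 2 \<and>
      x \<in> A \<and> y \<in> B \<and> (\<forall>a\<in>A. \<forall>b\<in>B. (a, b) \<in> parcs G \<longrightarrow> a = x \<and> b = y)"
    if xy: "(x, y) \<in> parcs G" for x y
  proof -
    let ?D = "delete_edge G (x, y)"
    have D: "pverts ?D = pverts G" "parcs ?D = parcs G - {(x, y), (y, x)}"
      unfolding delete_edge_def by auto
    have sym_D: "sym (parcs ?D)"
      using sym unfolding D sym_def by auto
    have "\<not> three_connected ?D" using m xy unfolding minimally_three_connected_def by blast
    then obtain S where S: "S \<subseteq> pverts G" "card S < 3"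
      and nc: "\<not> connected (with_proj ?D \<restriction> (pverts G - S))"
      unfolding three_connected_def D by blast
    define W where "W = pverts G - S"
    have finS: "finite S" using S(1) pair_finite_verts finite_subset by blast
    have "card W = card (pverts G) - card S" unfolding W_def using S finS by (intro card_Diff_subset)
    \<comment> \<open>Excludes the trivial failure of connectedness, so that an actual cut
      exists.\<close>
    then have "W \<noteq> {}" using n S by auto
    then obtain A where A: "A \<subseteq> W" "A \<noteq> {}" "A \<noteq> W"
      and none: "\<And>a b. a \<in> A \<Longrightarrow> b \<in> W - A \<Longrightarrow> (a, b) \<notin> parcs ?D"
      using nc unfolding connected_induce_iff[OF sym_D] W_def[symmetric] by blast
    \<comment> \<open>\<open>G\<close> still has an edge across this cut, necessarily the deleted
      one; its direction decides which side takes the role of \<open>A\<close>.\<close>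
    obtain a b where ab: "a \<in> A" "b \<in> W - A" "(a, b) \<in> parcs G"
      using conn[OF S(1) _ W_def A] S(2) by auto
    have only: "(u = x \<and> v = y) \<or> (u = y \<and> v = x)" if "u \<in> A" "v \<in> W - A" "(u, v) \<in> parcs G" for u v
      using none[OF that(1,2)] that(3) unfolding D by blast
    have V: "pverts G = A \<union> (W - A) \<union> S" "pverts G = (W - A) \<union> A \<union> S"
      using A(1) S(1) unfolding W_def by auto
    have disj: "A \<inter> S = {}" "(W - A) \<inter> S = {}" "A \<inter> (W - A) = {}" "(W - A) \<inter> A = {}"
      using A(1) unfolding W_def by auto
    have S2: "card S \<le> 2" using S(2) by linarith
    consider "a = x" "b = y" | "a = y" "b = x" using only[OF ab] by blast
    then show ?thesis
    proof cases
      case 1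
      then have "\<forall>u\<in>A. \<forall>v\<in>W - A. (u, v) \<in> parcs G \<longrightarrow> u = x \<and> v = y"
        using only ab by blast
      then show ?thesis using V(1) disj S2 ab 1 by metis
    next
      case 2
      then have "\<forall>u\<in>W - A. \<forall>v\<in>A. (u, v) \<in> parcs G \<longrightarrow> u = x \<and> v = y"
        using only ab sym by blast
      then show ?thesis using V(2) disj S2 ab 2 by metis
    qed
  qed
qed

section \<open>Recognition of the two extremal graphs\<close>

lemma pair_wf_digraph_complete_bipartite_graph: "pair_wf_digraph (complete_bipartite_graph a b)"
  by unfold_locales (auto simp: complete_bipartite_graph_def)

text \<open>Without the hub, every vertex has degree 2 by \<open>deg_eq_3_if_hub\<close>, and the
  rim is connected because \<open>{a}\<close> is too small to be a boundary; so the rim is a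
  cycle.\<close>

lemma digraph_iso_wheel_graph:
  assumes "pair_graph G" "min_3_connected_graph (pverts G) (parcs G)"
    and a: "a \<in> pverts G" "Suc (min_3_connected_graph.deg (parcs G) a) = card (pverts G)"
  shows "digraph_iso (with_proj G) (with_proj (wheel_graph (card (pverts G))))"
proof -
  interpret pair_graph G by fact
  interpret M: min_3_connected_graph "pverts G" "parcs G" by fact
  let ?n = "card (pverts G)"
  define W where "W = pverts G - {a}"
  define R where "R = {(x, y) \<in> parcs G. x \<in> W \<and> y \<in> W}"
  have n: "?n \<ge> 8" by (rule M.card_V)
  have cW: "card W = ?n - 1" unfolding W_def using a by simp
  have spoke: "(a, v) \<in> parcs G" "(v, a) \<in> parcs G" if "v \<in> W" for v
  proof -
    have "pverts G - insert a (M.nbrs a) = {}"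
      using M.card_non_nbrs[OF a(1)] a(2) by auto
    then show "(a, v) \<in> parcs G" using that unfolding W_def by auto
    then show "(v, a) \<in> parcs G" by (rule M.E_sym)
  qed
  have "\<exists>f. bij_betw f {..<card W} W \<and>
    (\<forall>i<card W. \<forall>j<card W. (f i, f j) \<in> R \<longleftrightarrow> j = Suc i mod card W \<or> i = Suc j mod card W)"
  proof (rule two_regular_connected_cycle)
    show "finite W" unfolding W_def by simp
    show "W \<noteq> {}" using cW n by auto
    show "R \<subseteq> W \<times> W" unfolding R_def by auto
    show "(y, x) \<in> R" if "(x, y) \<in> R" for x y using that M.E_sym unfolding R_def by auto
    show "(x, x) \<notin> R" for x using M.E_irrefl unfolding R_def by auto
    show "card {u. (w, u) \<in> R} = 2" if w: "w \<in> W" for w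
    proof -
      have "{u. (w, u) \<in> R} = M.nbrs w - {a}"
        using M.nbrs_subset[of w] w unfolding R_def W_def by auto
      moreover have "M.deg w = 3" using M.deg_eq_3_if_hub[OF a] w unfolding W_def by blast
      ultimately show ?thesis
        using spoke(2)[OF w] M.finite_nbrs[of w] unfolding M.deg_def by simp
    qed
    fix X assume X: "X \<subseteq> W" "X \<noteq> {}" and cl: "\<And>x y. x \<in> X \<Longrightarrow> (x, y) \<in> R \<Longrightarrow> y \<in> X"
    show "X = W"
    proof (rule ccontr)
      assume ne: "X \<noteq> W"
      have "card {a} \<ge> 3"
      proof (rule M.boundary_card)
        show "X \<subseteq> pverts G" "{a} \<subseteq> pverts G" "X \<inter> {a} = {}" "X \<union> {a} \<noteq> pverts G"
          using X ne a unfolding W_def by auto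
        show "X \<noteq> {}" by fact
        show "w \<in> X \<union> {a}" if "v \<in> X" "(v, w) \<in> parcs G" for v w
          using that cl[OF that(1), of w] X M.E_in_V[OF that(2)] unfolding R_def W_def by blast
      qed
      then show False by simp
    qed
  qed
  then obtain f where f: "bij_betw f {..<?n - 1} W"
    and adj: "\<And>i j. i < ?n - 1 \<Longrightarrow> j < ?n - 1 \<Longrightarrow>
      (f i, f j) \<in> R \<longleftrightarrow> j = Suc i mod (?n - 1) \<or> i = Suc j mod (?n - 1)"
    unfolding cW by blast
  define g where "g = f(?n - 1 := a)"
  have fW: "f i \<in> W" if "i < ?n - 1" for i using f that unfolding bij_betw_def by auto
  have "pair_graph (wheel_graph ?n)" using n by (intro pair_graph_wheel_graph) simp
  then have wf: "pair_wf_digraph (wheel_graph ?n)"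
    unfolding pair_graph_def pair_digraph_def pair_fin_digraph_def by blast
  have "digraph_iso (with_proj (wheel_graph ?n)) (with_proj G)"
  proof (rule digraph_iso_with_projI[OF wf])
    show "pair_wf_digraph G" by unfold_locales
    have "bij_betw g {..<?n - 1} W"
      using f by (rule bij_betw_cong[THEN iffD1, rotated]) (auto simp: g_def)
    then have "bij_betw g ({..<?n - 1} \<union> {?n - 1}) (W \<union> {a})"
      by (intro bij_betw_combine) (auto simp: g_def W_def)
    moreover have "pverts (wheel_graph ?n) = {..<?n - 1} \<union> {?n - 1}"
      unfolding wheel_graph_def cycle_graph_def Let_def by auto
    moreover have "pverts G = W \<union> {a}" using a unfolding W_def by auto
    ultimately show "bij_betw g (pverts (wheel_graph ?n)) (pverts G)" by simp
    fix i j assume ij: "i \<in> pverts (wheel_graph ?n)" "j \<in> pverts (wheel_graph ?n)"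
    then have lt: "i < ?n - 1 \<or> i = ?n - 1" "j < ?n - 1 \<or> j = ?n - 1"
      unfolding wheel_graph_def cycle_graph_def Let_def by auto
    have arc: "(i, j) \<in> parcs (wheel_graph ?n) \<longleftrightarrow>
      (if i = ?n - 1 then j \<noteq> ?n - 1 else if j = ?n - 1 then True
       else j = Suc i mod (?n - 1) \<or> i = Suc j mod (?n - 1))"
      using lt unfolding wheel_graph_def cycle_graph_def Let_def by auto
    consider "i = ?n - 1" "j = ?n - 1" | "i = ?n - 1" "j < ?n - 1" | "i < ?n - 1" "j = ?n - 1"
      | "i < ?n - 1" "j < ?n - 1" using lt by blast
    then show "(g i, g j) \<in> parcs G \<longleftrightarrow> (i, j) \<in> parcs (wheel_graph ?n)"
    proof cases
      case 1
      then show ?thesis unfolding arc g_def using M.E_irrefl by simp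
    next
      case 2
      then show ?thesis unfolding arc g_def using spoke(1)[OF fW[of j]] by simp
    next
      case 3
      then show ?thesis unfolding arc g_def using spoke(2)[OF fW[of i]] by simp
    next
      case 4
      then have "(f i, f j) \<in> parcs G \<longleftrightarrow> (f i, f j) \<in> R" using fW unfolding R_def by simp
      then show ?thesis unfolding arc g_def using 4 adj[OF 4] by simp
    qed
  qed
  then show ?thesis using digraph_iso_swap wf wf_digraph_wp_iff by blast
qed

lemma digraph_iso_complete_bipartite_graph:
  assumes "pair_wf_digraph G" and fin: "finite (pverts G)" and X: "X \<subseteq> pverts G"
    and E: "parcs G = X \<times> (pverts G - X) \<union> (pverts G - X) \<times> X"
  shows "digraph_iso (with_proj G) (with_proj (complete_bipartite_graph (card X) (card (pverts G) - card X)))"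
proof -
  let ?a = "card X" and ?Y = "pverts G - X"
  let ?b = "card (pverts G) - ?a"
  let ?K = "complete_bipartite_graph ?a ?b"
  have finX: "finite X" using fin X finite_subset by blast
  have cY: "card ?Y = ?b" using card_Diff_subset[OF finX X] .
  have "card {?a..<?a + ?b} = card ?Y" using cY by simp
  then obtain g h where g: "bij_betw g {..<?a} X" and h: "bij_betw h {?a..<?a + ?b} ?Y"
    using finite_same_card_bij[of "{..<?a}" X] finite_same_card_bij[of "{?a..<?a + ?b}" ?Y] fin finX by auto
  define f where "f i = (if i < ?a then g i else h i)" for i
  have fg: "bij_betw f {..<?a} X"
    using g by (rule bij_betw_cong[THEN iffD1, rotated]) (auto simp: f_def)
  have fh: "bij_betw f {?a..<?a + ?b} ?Y"
    using h by (rule bij_betw_cong[THEN iffD1, rotated]) (auto simp: f_def)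
  have "bij_betw f ({..<?a} \<union> {?a..<?a + ?b}) (X \<union> ?Y)"
    using fg fh by (intro bij_betw_combine) auto
  moreover have "{..<?a} \<union> {?a..<?a + ?b} = pverts ?K" unfolding complete_bipartite_graph_def by auto
  moreover have "X \<union> ?Y = pverts G" using X by auto
  ultimately have f: "bij_betw f (pverts ?K) (pverts G)" by simp
  have fX: "f i \<in> X \<longleftrightarrow> i < ?a" if "i \<in> pverts ?K" for i
  proof (cases "i < ?a")
    case True
    then show ?thesis using fg unfolding bij_betw_def by auto
  next
    case False
    then have "i \<in> {?a..<?a + ?b}" using that unfolding complete_bipartite_graph_def by auto
    then have "f i \<in> ?Y" using fh unfolding bij_betw_def by blast
    then show ?thesis using False by auto
  qed
  have "digraph_iso (with_proj ?K) (with_proj G)"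
  proof (rule digraph_iso_with_projI[OF pair_wf_digraph_complete_bipartite_graph assms(1) f])
    fix i j assume ij: "i \<in> pverts ?K" "j \<in> pverts ?K"
    then have "f i \<in> pverts G" "f j \<in> pverts G" using f unfolding bij_betw_def by auto
    then show "(f i, f j) \<in> parcs G \<longleftrightarrow> (i, j) \<in> parcs ?K"
      using fX[OF ij(1)] fX[OF ij(2)] ij unfolding E complete_bipartite_graph_def by auto
  qed
  then show ?thesis
    using digraph_iso_swap pair_wf_digraph_complete_bipartite_graph wf_digraph_wp_iff by blast
qed

section \<open>Case distinction by the largest degree\<close>

theorem theorem3:
  fixes G :: "'a pair_pre_digraph" and n p :: nat
  assumes "p > 1"
    and "pair_graph G"
    and "minimally_three_connected G"
    and "card (pverts G) = n"
    and "n \<ge> 8"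
  shows "degree_power_sum p G \<le>
           max (degree_power_sum p (wheel_graph n))
               (degree_power_sum p (complete_bipartite_graph 3 (n - 3)))
       \<and> (degree_power_sum p G =
           max (degree_power_sum p (wheel_graph n))
               (degree_power_sum p (complete_bipartite_graph 3 (n - 3)))
         \<longleftrightarrow>
           (digraph_iso (with_proj G) (with_proj (wheel_graph n))
             \<and> degree_power_sum p (wheel_graph n)
                 \<ge> degree_power_sum p (complete_bipartite_graph 3 (n - 3)))
         \<or> (digraph_iso (with_proj G) (with_proj (complete_bipartite_graph 3 (n - 3)))
             \<and> degree_power_sum p (complete_bipartite_graph 3 (n - 3))
                 \<ge> degree_power_sum p (wheel_graph n)))"
proof -
  interpret pair_graph G by fact
  have "min_3_connected_graph (pverts G) (parcs G)"
    using min_3_connected_graph assms by simp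
  then interpret M: min_3_connected_graph "pverts G" "parcs G" .
  have wf: "pair_wf_digraph G" by unfold_locales
  let ?W = "wheel_graph n" and ?K = "complete_bipartite_graph 3 (n - 3)"
  have eG: "degree_power_sum p G = M.power_sum p"
    unfolding degree_power_sum_def M.power_sum_def M.deg_def M.nbrs_def out_degree_with_proj ..
  have eW: "degree_power_sum p ?W = (card (pverts G) - 1) ^ p + (card (pverts G) - 1) * 3 ^ p"
    using degree_power_sum_wheel_graph assms by simp
  have eK: "degree_power_sum p ?K = 3 * (card (pverts G) - 3) ^ p + (card (pverts G) - 3) * 3 ^ p"
    using degree_power_sum_complete_bipartite_graph assms by simp
  have iso: "degree_power_sum p G = degree_power_sum p H"
    if "digraph_iso (with_proj G) (with_proj H)" for H :: "nat pair_pre_digraph"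
    by (rule degree_power_sum_iso[OF wf that])
  have deg_less: "M.deg v < card (pverts G)" if "v \<in> pverts G" for v
    using M.card_non_nbrs[OF that] by linarith
  consider (hub) a where "a \<in> pverts G" "Suc (M.deg a) = card (pverts G)"
    | (near) a where "a \<in> pverts G" "M.deg a + 2 = card (pverts G)"
    | (far) "\<And>v. v \<in> pverts G \<Longrightarrow> M.deg v + 3 \<le> card (pverts G)"
  proof (cases "\<exists>a\<in>pverts G. Suc (M.deg a) = card (pverts G) \<or> M.deg a + 2 = card (pverts G)")
    case True
    then show thesis using hub near by blast
  next
    case False
    have "M.deg v + 3 \<le> card (pverts G)" if "v \<in> pverts G" for v
    proof -
      have "Suc (M.deg v) \<noteq> card (pverts G)" "M.deg v + 2 \<noteq> card (pverts G)" using False that by blast+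
      then show ?thesis using deg_less[OF that] by linarith
    qed
    then show thesis by (rule far)
  qed
  \<comment> \<open>This suffices for both the bound and the equality case: isomorphic graphs have
    equal power sums, and a strict inequality against either value is strict against the
    maximum.\<close>
  then have "degree_power_sum p G < degree_power_sum p ?W \<or>
    digraph_iso (with_proj G) (with_proj ?W) \<or> degree_power_sum p G < degree_power_sum p ?K \<or>
    digraph_iso (with_proj G) (with_proj ?K)"
  proof cases
    case hub
    then show ?thesis using digraph_iso_wheel_graph[OF assms(2) M.min_3_connected_graph_axioms] assms(4) by blast
  next
    case near
    then show ?thesis using M.power_sum_less_wheel[OF near assms(1)] unfolding eG eW by blast
  next
    case far
    show ?thesis
    proof (cases "degree_power_sum p G = degree_power_sum p ?K")
      case True
      then have "card M.big = 3 \<and> (\<forall>v\<in>M.big. M.deg v + 3 = card (pverts G))"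
        unfolding eG eK by (intro M.power_sum_le_bipartite(2)[OF far assms(1)])
      then have big: "card M.big = 3" and "parcs G = M.big \<times> (pverts G - M.big) \<union> (pverts G - M.big) \<times> M.big"
        using M.bipartite_if_three_big by blast+
      then show ?thesis
        using digraph_iso_complete_bipartite_graph[OF wf _ M.big_subset] assms(4) by simp
    next
      case False
      then show ?thesis using M.power_sum_le_bipartite(1)[OF far assms(1)] unfolding eG eK by linarith
    qed
  qed
  then show ?thesis using iso[of ?W] iso[of ?K] by fastforce
qed

end
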